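(* Let $X$ be a path connected, locally path connected, semilocally simply connected, locally compact, Hausdorff and second countable space. Then the (topological) fundamental groupoid $\Pi_1(X)$ has a Haar system.
   Context: **Fundamental groupoid.** $\Pi_1(X)$ is the groupoid of endpoint-fixing homotopy classes $[\gamma]$ of paths $\gamma\colon[0,1]\to X$, with range $r([\gamma])=\gamma(1)$, source $s([\gamma])=\gamma(0)$, and unit space $X$ (constant paths). The product $[\gamma][\delta]$ is defined when $\gamma(0)=\delta(1)$ and is the class of the concatenation "first $\delta$, then $\gamma$", written $[\gamma * \delta]$. For $X$ locally path connected and semilocally simply connected, $\Pi_1(X)$ is topologised as the quotient of the path space with the compact-open topology. Equivalently, a basis is given by the sets $N([\gamma],U,V)=\{[\delta * \gamma * \omega] : \delta \text{ a path in } U,\ \delta(0)=\gamma(1),\ \omega \text{ a path in } V,\ \omega(1)=\gamma(0)\}$, where $U,V\subseteq X$ are path connected open sets whose inclusions into $X$ induce trivial maps on fundamental groups, and $\gamma$ is a path with $\gamma(0)\in V$, $\gamma(1)\in U$. This makes $\Pi_1(X)$ a topological groupoid. **Haar system.** For a locally compact groupoid $G$ with unit space $G^{(0)}$, put $G^u=r^{-1}(u)$. A Haar system on $G$ is a family $\{\alpha^u\}_{u\in G^{(0)}}$ of positive Radon measures on $G$ such that: $\alpha^u$ has support $G^u$; for every $f\in C_c(G)$ the function $u\mapsto\int f\,d\alpha^u$ is in $C_c(G^{(0)})$; and for all $\gamma\in G$, $f\in C_c(G)$, $\int_{G^{s(\gamma)}} f(\gamma\eta)\,d\alpha^{s(\gamma)}(\eta)=\int_{G^{r(\gamma)}}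 f(\eta)\,d\alpha^{r(\gamma)}(\eta)$. *)

theory Defs
  imports "HOL-Analysis.Analysis"
begin

section \<open>Paths up to homotopy\<close>

definition path_homotopic :: "'a topology \<Rightarrow> (real \<Rightarrow> 'a) \<Rightarrow> (real \<Rightarrow> 'a) \<Rightarrow> bool" where
  "path_homotopic X p q \<longleftrightarrow>
     homotopic_with (\<lambda>h. h 0 = p 0 \<and> h 1 = p 1) (top_of_set {0..1}) X p q"

lemma path_homotopic_top_of_set: "path_homotopic (top_of_set S) p q \<longleftrightarrow> homotopic_paths S p q"
  by (simp add: path_homotopic_def homotopic_paths_def pathstart_def pathfinish_def)

definition path_class :: "'a topology \<Rightarrow> (real \<Rightarrow> 'a) \<Rightarrow> (real \<Rightarrow> 'a) set" where
  "path_class X p = {q. path_homotopic X p q}"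

text \<open>The library's \<open>joinpaths\<close> and \<open>reversepath\<close> are tied to the type class
  \<^class>\<open>topological_space\<close>; these are the same formulas for a space given by a value of
  type \<^typ>\<open>'a topology\<close>.\<close>

definition path_then :: "(real \<Rightarrow> 'a) \<Rightarrow> (real \<Rightarrow> 'a) \<Rightarrow> real \<Rightarrow> 'a" where
  "path_then p q = (\<lambda>t. if t \<le> 1/2 then p (2 * t) else q (2 * t - 1))"

lemma path_then_joinpaths: "path_then p q = p +++ q"
  by (simp add: path_then_def joinpaths_def)

definition path_reverse :: "(real \<Rightarrow> 'a) \<Rightarrow> real \<Rightarrow> 'a" where
  "path_reverse p = (\<lambda>t. p (1 - t))"

lemma path_reverse_reversepath: "path_reverse p = reversepath p"
  by (simp add: path_reverse_def reversepath_def)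

definition semilocally_simply_connected :: "'a topology \<Rightarrow> bool" where
  "semilocally_simply_connected X \<longleftrightarrow>
     (\<forall>x \<in> topspace X. \<exists>U. openin X U \<and> x \<in> U \<and>
        (\<forall>p. pathin (subtopology X U) p \<and> p 0 = x \<and> p 1 = x \<longrightarrow> path_homotopic X p (\<lambda>t. x)))"


section \<open>Function spaces and quotient topologies\<close>

text \<open>Functions are not required to be extensional. For \<open>X = [0,1]\<close> this means that
  functions which agree on \<open>[0,1]\<close> are topologically indistinguishable; they are also path
  homotopic, so the quotient by \<^const>\<open>path_class\<close> is the usual one.\<close>

definition compact_open_topology :: "'a topology \<Rightarrow> 'b topology \<Rightarrow> ('a \<Rightarrow> 'b) topology" where
  "compact_open_topology X Y = topology_generated_by
     {{f. continuous_map X Y f \<and> f ` K \<subseteq> U} | K U. compactin X K \<and> openin Y U}"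

lemma topspace_compact_open_topology [simp]:
  "topspace (compact_open_topology X Y) = {f. continuous_map X Y f}"
proof -
  have "{f. continuous_map X Y f} = {f. continuous_map X Y f \<and> f ` {} \<subseteq> topspace Y}"
    by simp
  then have "{f. continuous_map X Y f} \<in>
      {{f. continuous_map X Y f \<and> f ` K \<subseteq> U} | K U. compactin X K \<and> openin Y U}"
    using compactin_empty[of X] openin_topspace[of Y] by blast
  then show ?thesis
    unfolding compact_open_topology_def topology_generated_by_topspace by blast
qed

definition quotient_topology :: "'a topology \<Rightarrow> ('a \<Rightarrow> 'b) \<Rightarrow> 'b topology" where
  "quotient_topology X q =
     topology (\<lambda>V. V \<subseteq> q ` topspace X \<and> openin X {x \<in> topspace X. q x \<in> V})"

lemma openin_quotient_topology:
  "openin (quotient_topology X q) V \<longleftrightarrow>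
     V \<subseteq> q ` topspace X \<and> openin X {x \<in> topspace X. q x \<in> V}"
proof -
  have "istopology (\<lambda>V. V \<subseteq> q ` topspace X \<and> openin X {x \<in> topspace X. q x \<in> V})"
    unfolding istopology_def
  proof (intro conjI allI impI)
    fix S T
    assume S: "S \<subseteq> q ` topspace X \<and> openin X {x \<in> topspace X. q x \<in> S}"
      and T: "T \<subseteq> q ` topspace X \<and> openin X {x \<in> topspace X. q x \<in> T}"
    then show "S \<inter> T \<subseteq> q ` topspace X" by blast
    have "{x \<in> topspace X. q x \<in> S \<inter> T} =
        {x \<in> topspace X. q x \<in> S} \<inter> {x \<in> topspace X. q x \<in> T}" by blast
    then show "openin X {x \<in> topspace X. q x \<in> S \<inter> T}"
      using S T by (simp only: openin_Int)
  next
    fix \<K>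
    assume K: "\<forall>K\<in>\<K>. K \<subseteq> q ` topspace X \<and> openin X {x \<in> topspace X. q x \<in> K}"
    then show "\<Union>\<K> \<subseteq> q ` topspace X" by blast
    have "{x \<in> topspace X. q x \<in> \<Union>\<K>} = (\<Union>K\<in>\<K>. {x \<in> topspace X. q x \<in> K})" by blast
    moreover have "openin X (\<Union>K\<in>\<K>. {x \<in> topspace X. q x \<in> K})"
      using K by (intro openin_Union) auto
    ultimately show "openin X {x \<in> topspace X. q x \<in> \<Union>\<K>}"
      by simp
  qed
  then show ?thesis
    by (simp add: quotient_topology_def topology_inverse')
qed

lemma quotient_map_quotient_topology: "quotient_map X (quotient_topology X q) q"
proof -
  have "openin (quotient_topology X q) (q ` topspace X)"
  proof -
    have "{x \<in> topspace X. q x \<in> q ` topspace X} = topspace X" by blast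
    then show ?thesis by (simp add: openin_quotient_topology)
  qed
  then have "topspace (quotient_topology X q) = q ` topspace X"
    by (meson openin_quotient_topology openin_subset openin_topspace subset_antisym)
  then show ?thesis
    by (simp add: quotient_map_def openin_quotient_topology)
qed


section \<open>Locally compact groupoids and Haar systems\<close>

text \<open>The unit space is a space of its own, included in the groupoid by \<open>unit_arrow\<close>. In a
  topological groupoid (below) this inclusion is a homeomorphism onto its image, since
  \<open>src\<close> is a continuous left inverse.\<close>

record ('u, 'g) groupoid =
  arrows :: "'g topology"
  units :: "'u topology"
  rng :: "'g \<Rightarrow> 'u"
  src :: "'g \<Rightarrow> 'u"
  unit_arrow :: "'u \<Rightarrow> 'g"
  mult_arrow :: "'g \<Rightarrow> 'g \<Rightarrow> 'g"
  inv_arrow :: "'g \<Rightarrow> 'g"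

definition composable :: "('u, 'g) groupoid \<Rightarrow> ('g \<times> 'g) set" where
  "composable G = {(a, b). a \<in> topspace (arrows G) \<and> b \<in> topspace (arrows G) \<and> src G a = rng G b}"

locale topological_groupoid =
  fixes G :: "('u, 'g) groupoid"
  assumes continuous_rng: "continuous_map (arrows G) (units G) (rng G)"
    and continuous_src: "continuous_map (arrows G) (units G) (src G)"
    and continuous_unit_arrow: "continuous_map (units G) (arrows G) (unit_arrow G)"
    and continuous_mult_arrow:
      "continuous_map (subtopology (prod_topology (arrows G) (arrows G)) (composable G)) (arrows G)
         (\<lambda>(a, b). mult_arrow G a b)"
    and continuous_inv_arrow: "continuous_map (arrows G) (arrows G) (inv_arrow G)"
    and unit_arrow_ends: "u \<in> topspace (units G) \<Longrightarrow>
      rng G (unit_arrow G u) = u \<and> src G (unit_arrow G u) = u"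
    and mult_arrow_ends: "(a, b) \<in> composable G \<Longrightarrow>
      rng G (mult_arrow G a b) = rng G a \<and> src G (mult_arrow G a b) = src G b"
    and mult_arrow_assoc: "(a, b) \<in> composable G \<Longrightarrow> (b, c) \<in> composable G \<Longrightarrow>
      mult_arrow G (mult_arrow G a b) c = mult_arrow G a (mult_arrow G b c)"
    and mult_unit_arrow: "a \<in> topspace (arrows G) \<Longrightarrow>
      mult_arrow G (unit_arrow G (rng G a)) a = a \<and> mult_arrow G a (unit_arrow G (src G a)) = a"
    and inv_arrow_ends: "a \<in> topspace (arrows G) \<Longrightarrow>
      rng G (inv_arrow G a) = src G a \<and> src G (inv_arrow G a) = rng G a"
    and mult_inv_arrow: "a \<in> topspace (arrows G) \<Longrightarrow>
      mult_arrow G a (inv_arrow G a) = unit_arrow G (rng G a) \<and>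
      mult_arrow G (inv_arrow G a) a = unit_arrow G (src G a)"

text \<open>``Locally compact'' includes the Hausdorff property, as usual in this context.\<close>

locale locally_compact_groupoid = topological_groupoid +
  assumes locally_compact_arrows: "locally_compact_space (arrows G)"
    and Hausdorff_arrows: "Hausdorff_space (arrows G)"

definition radon_measure :: "'g topology \<Rightarrow> 'g measure \<Rightarrow> bool" where
  "radon_measure T M \<longleftrightarrow>
     space M = topspace T \<and>
     sets M = sigma_sets (topspace T) {U. openin T U} \<and>
     (\<forall>K. compactin T K \<longrightarrow> emeasure M K < \<infinity>) \<and>
     (\<forall>A \<in> sets M. emeasure M A = (INF U \<in> {U. openin T U \<and> A \<subseteq> U}. emeasure M U)) \<and>
     (\<forall>U. openin T U \<longrightarrow> emeasure M U = (SUP K \<in> {K. compactin T K \<and> K \<subseteq> U}. emeasure M K))"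

definition measure_support :: "'g topology \<Rightarrow> 'g measure \<Rightarrow> 'g set" where
  "measure_support T M =
     {x \<in> topspace T. \<forall>U. openin T U \<and> x \<in> U \<longrightarrow> 0 < emeasure M U}"

definition Cc :: "'a topology \<Rightarrow> ('a \<Rightarrow> complex) set" where
  "Cc T = {f. continuous_map T euclidean f \<and>
              compactin T (T closure_of {x \<in> topspace T. f x \<noteq> 0})}"

definition range_fibre :: "('u, 'g) groupoid \<Rightarrow> 'u \<Rightarrow> 'g set" where
  "range_fibre G u = {a \<in> topspace (arrows G). rng G a = u}"

locale haar_system = locally_compact_groupoid G
  for G :: "('u, 'g) groupoid" +
  fixes \<alpha> :: "'u \<Rightarrow> 'g measure"
  assumes radon: "u \<in> topspace (units G) \<Longrightarrow> radon_measure (arrows G) (\<alpha> u)"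
    and support: "u \<in> topspace (units G) \<Longrightarrow>
      measure_support (arrows G) (\<alpha> u) = range_fibre G u"
    and continuity: "f \<in> Cc (arrows G) \<Longrightarrow> (\<lambda>u. LINT \<eta>|\<alpha> u. f \<eta>) \<in> Cc (units G)"
    and invariance: "a \<in> topspace (arrows G) \<Longrightarrow> f \<in> Cc (arrows G) \<Longrightarrow>
      (LINT \<eta>:range_fibre G (src G a)|\<alpha> (src G a). f (mult_arrow G a \<eta>)) =
      (LINT \<eta>:range_fibre G (rng G a)|\<alpha> (rng G a). f \<eta>)"


section \<open>The fundamental groupoid\<close>

text \<open>An arrow is a homotopy class \<open>a\<close> of paths, so \<open>(\<lambda>p. p 0) ` a\<close> is a singleton. The
  class of a product (or inverse) is written as the union of the classes obtained from all
  representatives; these classes coincide. In \<open>mult_arrow\<close>, the second factor is traversed first.\<close>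

definition fundamental_groupoid :: "'a topology \<Rightarrow> ('a, (real \<Rightarrow> 'a) set) groupoid" where
  "fundamental_groupoid X =
     \<lparr> arrows = quotient_topology (compact_open_topology (top_of_set {0..1}) X) (path_class X),
       units = X,
       rng = (\<lambda>a. the_elem ((\<lambda>p. p 1) ` a)),
       src = (\<lambda>a. the_elem ((\<lambda>p. p 0) ` a)),
       unit_arrow = (\<lambda>x. path_class X (\<lambda>t. x)),
       mult_arrow = (\<lambda>a b. \<Union>p\<in>a. \<Union>q\<in>b. path_class X (path_then q p)),
       inv_arrow = (\<lambda>a. \<Union>p\<in>a. path_class X (path_reverse p)) \<rparr>"

end

theory Submission
  imports Defs
begin

text \<open>The unit space \<open>X\<close> carries a finite atomic measure \<open>\<mu> = \<Sum>x\<in>D. w x \<delta>\<^sub>x\<close> of full support, for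
  \<open>D\<close> countable and dense. The source map \<open>r\<^sup>-\<^sup>1(u) \<rightarrow> X\<close> is a covering (the universal
  one), and \<open>\<alpha>\<^sup>u\<close> is the lift of \<open>\<mu>\<close> along it: the point mass at each
  \<open>h \<in> r\<^sup>-\<^sup>1(u)\<close> with \<open>s(h) \<in> D\<close> is \<open>w (s h)\<close>. Left multiplication by an arrow does not change
  sources, so this family is invariant. On a basic open set \<open>N(g, U, V)\<close> the pair \<open>(r, s)\<close> is a
  homeomorphism onto \<open>U \<times> V\<close>, so that for \<open>f \<in> C\<^sub>c\<close> the integral is, near a given \<open>u\<close>, a
  uniformly convergent sum of continuous functions. Outer regularity needs the fibres to be
  \<open>\<sigma>\<close>-compact, i.e. \<open>\<pi>\<^sub>1(X)\<close> to be countable; this is where second countability is used a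
  second time.\<close>

section \<open>Homotopies of paths\<close>

text \<open>An atomic measure on \<open>X\<close> is chosen because its lift to a fibre is a
  weighted sum: invariance becomes reindexing along a bijection, continuity becomes the Weierstrass
  M-test, and nothing has to be glued from local charts. The weights have finite total mass, which
  makes the lift finite on every basic open set. The obstacle is the topology. Arrows carry the
  quotient of the compact-open topology, whereas every argument about the measures wants the sets
  \<open>nbr g U V\<close>. The proof is therefore cut at \<open>flat_groupoid\<close>, which
  postulates these sets as a basis. For paths, that they are open follows by propagating a property
  along a path through good sets; that they are fine enough follows by making a path pause at its
  ends. Both topological statements, and the countability of the cover, rest on the same calculus of
  sliding an arrow along short arrows at its two ends.\<close>

lemma pathin_reparam:
  assumes "pathin X p" "path f" "path_image f \<subseteq> {0..1}"
  shows "pathin X (p \<circ> f)"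
proof -
  have "continuous_map (top_of_set {0..1}) (top_of_set {0..1}) f"
    using assms(2,3) by (auto simp: path_def path_image_def)
  then show ?thesis
    using assms(1) unfolding pathin_def by (rule continuous_map_compose)
qed

text \<open>The interval is convex, so \<open>f\<close> and \<open>g\<close> are joined by the
  straight-line homotopy, which keeps the common ends fixed; composing it with \<open>p\<close>
  gives the result. The groupoid laws below are all obtained in this way.\<close>

lemma path_homotopic_reparam:
  assumes "pathin X p" "path f" "path_image f \<subseteq> {0..1}" "path g" "path_image g \<subseteq> {0..1}"
    and "f 0 = g 0" "f 1 = g 1"
  shows "path_homotopic X (p \<circ> f) (p \<circ> g)"
proof -
  have "homotopic_paths {0..1} f g"
    using assms by (intro homotopic_paths_linear)
      (auto simp: pathstart_def pathfinish_def closed_segment_subset path_image_def image_subset_iff)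
  then have "homotopic_with (\<lambda>h. h 0 = f 0 \<and> h 1 = f 1) (top_of_set {0..1}) (top_of_set {0..1}) f g"
    by (simp add: homotopic_paths_def pathstart_def pathfinish_def)
  then show ?thesis
    using assms(1) unfolding path_homotopic_def pathin_def
    by (rule homotopic_with_compose_continuous_map_left) auto
qed

lemma path_homotopic_imp:
  assumes "path_homotopic X p q"
  shows "pathin X p" "pathin X q" "q 0 = p 0" "q 1 = p 1"
  using homotopic_with_imp_continuous_maps[OF assms[unfolded path_homotopic_def]]
    homotopic_with_imp_property[OF assms[unfolded path_homotopic_def]]
  by (auto simp: pathin_def)

lemma path_homotopic_refl: "pathin X p \<Longrightarrow> path_homotopic X p p"
  by (simp add: path_homotopic_def pathin_def)

lemma path_homotopic_sym:
  assumes "path_homotopic X p q"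
  shows "path_homotopic X q p"
  using homotopic_with_symD[OF assms[unfolded path_homotopic_def]] path_homotopic_imp[OF assms]
  by (simp add: path_homotopic_def)

lemma path_homotopic_trans:
  assumes "path_homotopic X p q" "path_homotopic X q r"
  shows "path_homotopic X p r"
  unfolding path_homotopic_def
proof (rule homotopic_with_trans)
  show "homotopic_with (\<lambda>h. h 0 = p 0 \<and> h 1 = p 1) (top_of_set {0..1}) X p q"
    using assms(1) by (simp add: path_homotopic_def)
  show "homotopic_with (\<lambda>h. h 0 = p 0 \<and> h 1 = p 1) (top_of_set {0..1}) X q r"
    using assms(2) path_homotopic_imp[OF assms(1)] by (simp add: path_homotopic_def)
qed

lemma path_class_eq_iff:
  assumes "pathin X p"
  shows "path_class X p = path_class X q \<longleftrightarrow> path_homotopic X p q"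
proof
  assume "path_class X p = path_class X q"
  then have "p \<in> path_class X q"
    using path_homotopic_refl[OF assms] by (auto simp: path_class_def)
  then show "path_homotopic X p q"
    by (auto simp: path_class_def intro: path_homotopic_sym)
next
  assume "path_homotopic X p q"
  then show "path_class X p = path_class X q"
    unfolding path_class_def by (blast intro: path_homotopic_sym path_homotopic_trans)
qed

text \<open>\<open>T\<close> is the homotopy parameter. Two homotopies are set side by side; the
  closed pieces \<open>snd z \<le> 1/2\<close> and \<open>1/2 \<le> snd z\<close> meet where the
  last hypothesis makes both formulas agree.\<close>

lemma continuous_map_halves:
  fixes f g :: "'b \<times> real \<Rightarrow> 'a"
  assumes "continuous_map (prod_topology T (top_of_set {0..1})) X f"
    and "continuous_map (prod_topology T (top_of_set {0..1})) X g"
    and "\<And>s. s \<in> topspace T \<Longrightarrow> f (s, 1) = g (s, 0)"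
  shows "continuous_map (prod_topology T (top_of_set {0..1})) X
    (\<lambda>z. if snd z \<le> 1/2 then f (fst z, 2 * snd z) else g (fst z, 2 * snd z - 1))"
proof (rule continuous_map_cases_le)
  let ?P = "prod_topology T (top_of_set {0..1::real})"
  have snd: "continuous_map ?P euclideanreal snd"
    using continuous_map_snd continuous_map_into_fulltopology by blast
  then show "continuous_map ?P euclideanreal snd" .
  show "continuous_map ?P euclideanreal (\<lambda>z. 1/2)"
    by simp
  have into: "continuous_map (subtopology ?P S) ?P (\<lambda>z. (fst z, h (snd z)))"
    if "continuous_on UNIV h" "\<And>z. z \<in> topspace ?P \<Longrightarrow> z \<in> S \<Longrightarrow> h (snd z) \<in> {0..1}" for S h
  proof -
    have "continuous_map (subtopology ?P S) euclideanreal (h \<circ> snd)"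
      using that(1) by (intro continuous_map_compose[OF continuous_map_from_subtopology[OF snd]]) auto
    then have "continuous_map (subtopology ?P S) (top_of_set {0..1}) (\<lambda>z. h (snd z))"
      using that(2) by (auto simp: continuous_map_in_subtopology o_def)
    then show ?thesis
      by (rule continuous_map_pairedI[OF continuous_map_from_subtopology[OF continuous_map_fst]])
  qed
  have "continuous_map (subtopology ?P {z \<in> topspace ?P. snd z \<le> 1/2}) ?P (\<lambda>z. (fst z, 2 * snd z))"
    by (rule into) (auto intro!: continuous_intros)
  from continuous_map_compose[OF this assms(1)]
  show "continuous_map (subtopology ?P {z \<in> topspace ?P. snd z \<le> 1/2}) X (\<lambda>z. f (fst z, 2 * snd z))"
    by (simp add: o_def)
  have "continuous_map (subtopology ?P {z \<in> topspace ?P. 1/2 \<le> snd z}) ?P (\<lambda>z. (fst z, 2 * snd z - 1))"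
    by (rule into) (auto intro!: continuous_intros)
  from continuous_map_compose[OF this assms(2)]
  show "continuous_map (subtopology ?P {z \<in> topspace ?P. 1/2 \<le> snd z}) X (\<lambda>z. g (fst z, 2 * snd z - 1))"
    by (simp add: o_def)
  show "f (fst z, 2 * snd z) = g (fst z, 2 * snd z - 1)"
    if "z \<in> topspace ?P" "snd z = 1/2" for z
  proof -
    have "2 * snd z = 1" using that by simp
    then show ?thesis using that assms(3)[of "fst z"] by (simp only: mem_Sigma_iff) auto
  qed
qed

lemma path_homotopic_path_then:
  assumes "path_homotopic X p p'" "path_homotopic X q q'" "p 1 = q 0"
  shows "path_homotopic X (path_then p q) (path_then p' q')"
proof -
  obtain h where h: "continuous_map (prod_topology (top_of_set {0..1}) (top_of_set {0..1})) X h"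
    "\<And>x. h (0, x) = p x" "\<And>x. h (1, x) = p' x"
    "\<And>t. t \<in> {0..1::real} \<Longrightarrow> h (t, 0) = p 0 \<and> h (t, 1) = p 1"
    using assms(1) unfolding path_homotopic_def homotopic_with_def by auto
  obtain k where k: "continuous_map (prod_topology (top_of_set {0..1}) (top_of_set {0..1})) X k"
    "\<And>x. k (0, x) = q x" "\<And>x. k (1, x) = q' x"
    "\<And>t. t \<in> {0..1::real} \<Longrightarrow> k (t, 0) = q 0 \<and> k (t, 1) = q 1"
    using assms(2) unfolding path_homotopic_def homotopic_with_def by auto
  show ?thesis
    unfolding path_homotopic_def homotopic_with_def
  proof (intro exI conjI ballI allI)
    show "continuous_map (prod_topology (top_of_set {0..1}) (top_of_set {0..1})) X
        (\<lambda>z. if snd z \<le> 1/2 then h (fst z, 2 * snd z) else k (fst z, 2 * snd z - 1))"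
      using h k assms(3) by (intro continuous_map_halves) auto
  qed (use h k in \<open>auto simp: path_then_def\<close>)
qed

lemma pathin_path_then:
  assumes "pathin X p" "pathin X q" "p 1 = q 0"
  shows "pathin X (path_then p q)"
  using path_homotopic_imp(1) path_homotopic_path_then path_homotopic_refl assms by metis

lemma path_then_ends [simp]: "path_then p q 0 = p 0" "path_then p q 1 = q 1"
  by (auto simp: path_then_def)

lemma path_reverse_ends [simp]: "path_reverse p 0 = p 1" "path_reverse p 1 = p 0"
  by (auto simp: path_reverse_def)

lemma path_reverse_reparam: "path_reverse p = p \<circ> (\<lambda>t. 1 - t)"
  by (auto simp: path_reverse_def)

lemma continuous_on_imp_path: "continuous_on {0..1} f \<Longrightarrow> path f"
  by (simp add: path_def)

lemma pathin_path_reverse: "pathin X p \<Longrightarrow> pathin X (path_reverse p)"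
  unfolding path_reverse_reparam
  by (rule pathin_reparam) (auto intro!: continuous_on_imp_path continuous_intros simp: path_image_def)

lemma path_homotopic_path_reverse:
  assumes "path_homotopic X p q"
  shows "path_homotopic X (path_reverse p) (path_reverse q)"
  using assms unfolding path_homotopic_def path_reverse_reparam
  by (rule homotopic_with_compose_continuous_map_right)
    (auto intro!: continuous_intros simp: continuous_map_in_subtopology)

lemma path_homotopic_cong:
  assumes "pathin X p" "\<And>t. t \<in> {0..1} \<Longrightarrow> p t = q t"
  shows "path_homotopic X p q"
  using assms unfolding path_homotopic_def pathin_def
  by (intro homotopic_with_equal) auto

text \<open>Both sides of a groupoid law are one path \<open>r\<close> run at different speeds.
  Agreement is asked only on \<open>{0..1}\<close>, since the values of a path elsewhere are
  arbitrary.\<close>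

lemma path_homotopic_common_reparam:
  assumes "pathin X r"
    and "path f" "path_image f \<subseteq> {0..1}" "path g" "path_image g \<subseteq> {0..1}" "f 0 = g 0" "f 1 = g 1"
    and "\<And>t. t \<in> {0..1} \<Longrightarrow> r (f t) = p t" "\<And>t. t \<in> {0..1} \<Longrightarrow> r (g t) = q t"
  shows "path_homotopic X p q"
proof -
  have "path_homotopic X (r \<circ> f) (r \<circ> g)"
    using assms by (intro path_homotopic_reparam)
  moreover have "path_homotopic X (r \<circ> f) p" "path_homotopic X (r \<circ> g) q"
    using assms by (auto intro!: path_homotopic_cong pathin_reparam)
  ultimately show ?thesis
    by (blast intro: path_homotopic_trans path_homotopic_sym)
qed

section \<open>Groupoid laws up to homotopy\<close>

lemma path_homotopic_assoc:
  assumes "pathin X p" "pathin X q" "pathin X r" "p 1 = q 0" "q 1 = r 0"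
  shows "path_homotopic X (path_then p (path_then q r)) (path_then (path_then p q) r)"
proof (rule path_homotopic_common_reparam)
  \<comment> \<open>The piecewise linear map with slopes 1/2, 1, 2 and breaks at 1/2 and 3/4, which
    carries the time intervals of \<open>p\<close>, \<open>q\<close>, \<open>r\<close> on the
    left-hand side to those on the right. In terms of \<open>max\<close> and \<open>min\<close> its
    continuity is immediate.\<close>
  let ?g = "\<lambda>t::real. max (min (t/2) (1/4)) (max (min (t - 1/4) (1/2)) (2 * t - 1))"
  show "pathin X (path_then (path_then p q) r)"
    using assms by (intro pathin_path_then) auto
  show "path ?g" "path (\<lambda>t::real. t)"
    by (auto intro!: continuous_on_imp_path continuous_intros)
  show "path_image ?g \<subseteq> {0..1}" "path_image (\<lambda>t::real. t) \<subseteq> {0..1}"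
    by (auto simp: path_image_def max_def min_def)
  show "path_then (path_then p q) r (?g t) = path_then p (path_then q r) t" if t: "t \<in> {0..1}" for t
  proof -
    consider "t \<le> 1/2" | "1/2 < t" "t \<le> 3/4" | "3/4 < t" by linarith
    then show ?thesis
    proof cases
      case 1
      then have "?g t = t / 2" by (auto simp: max_def min_def)
      then show ?thesis using 1 by (simp add: path_then_def)
    next
      case 2
      then have "?g t = t - 1/4" by (auto simp: max_def min_def)
      then show ?thesis using 2 by (simp add: path_then_def algebra_simps)
    next
      case 3
      then have "?g t = 2 * t - 1" by (auto simp: max_def min_def)
      then show ?thesis using 3 by (simp add: path_then_def algebra_simps)
    qed
  qed
qed auto

lemma path_homotopic_const_then:
  assumes "pathin X p"
  shows "path_homotopic X (path_then (\<lambda>t. p 0) p) p"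
proof (rule path_homotopic_common_reparam)
  let ?f = "\<lambda>t::real. max 0 (2 * t - 1)"
  show "path ?f" "path (\<lambda>t::real. t)"
    by (auto intro!: continuous_on_imp_path continuous_intros)
  show "path_image ?f \<subseteq> {0..1}" "path_image (\<lambda>t::real. t) \<subseteq> {0..1}"
    by (auto simp: path_image_def)
  show "p (?f t) = path_then (\<lambda>t. p 0) p t" for t
  proof (cases "t = 1/2")
    case False
    then show ?thesis by (auto simp: path_then_def max_def)
  qed (simp only: path_then_def, simp)
qed (auto simp: assms)

lemma path_homotopic_then_const:
  assumes "pathin X p"
  shows "path_homotopic X (path_then p (\<lambda>t. p 1)) p"
proof (rule path_homotopic_common_reparam)
  let ?f = "\<lambda>t::real. min 1 (2 * t)"
  show "path ?f" "path (\<lambda>t::real. t)"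
    by (auto intro!: continuous_on_imp_path continuous_intros)
  show "path_image ?f \<subseteq> {0..1}" "path_image (\<lambda>t::real. t) \<subseteq> {0..1}"
    by (auto simp: path_image_def)
  show "p (?f t) = path_then p (\<lambda>t. p 1) t" for t
  proof (cases "t = 1/2")
    case False
    then show ?thesis by (auto simp: path_then_def min_def)
  qed (simp only: path_then_def, simp)
qed (auto simp: assms)

lemma path_homotopic_then_reverse:
  assumes "pathin X p"
  shows "path_homotopic X (path_then p (path_reverse p)) (\<lambda>t. p 0)"
proof (rule path_homotopic_common_reparam)
  \<comment> \<open>The tent map runs along \<open>p\<close> and back. It starts and ends at 0, like
    the constant map 0 with which it is compared.\<close>
  let ?f = "\<lambda>t::real. min (2 * t) (2 - 2 * t)"
  show "path ?f" "path (\<lambda>t::real. 0::real)"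
    by (auto intro!: continuous_on_imp_path continuous_intros)
  show "path_image ?f \<subseteq> {0..1}" "path_image (\<lambda>t::real. 0::real) \<subseteq> {0..1}"
    by (auto simp: path_image_def)
qed (auto simp: assms path_then_def path_reverse_def min_def algebra_simps)

lemma path_homotopic_reverse_then:
  assumes "pathin X p"
  shows "path_homotopic X (path_then (path_reverse p) p) (\<lambda>t. p 1)"
  using path_homotopic_then_reverse[OF pathin_path_reverse[OF assms]]
  by (simp add: path_reverse_def)

section \<open>Segments of a path\<close>

text \<open>The segment runs backwards if \<open>b < a\<close>.\<close>

definition path_segment :: "(real \<Rightarrow> 'a) \<Rightarrow> real \<Rightarrow> real \<Rightarrow> real \<Rightarrow> 'a" where
  "path_segment p a b = (\<lambda>t. p (a + t * (b - a)))"

lemma path_segment_ends [simp]: "path_segment p a b 0 = p a" "path_segment p a b 1 = p b"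
  by (auto simp: path_segment_def)

lemma path_segment_full [simp]: "path_segment p 0 1 = p"
  by (simp add: path_segment_def)

lemma convex_combination_in:
  assumes "a \<in> {c..d}" "b \<in> {c..d}" "t \<in> {0..1}"
  shows "a + t * (b - a) \<in> {c..d::real}"
proof -
  have "(1 - t) *\<^sub>R a + t *\<^sub>R b \<in> {c..d}"
    using assms by (intro convexD) auto
  then show ?thesis by (simp add: algebra_simps)
qed

lemma pathin_path_segment:
  assumes "pathin X p" "a \<in> {0..1}" "b \<in> {0..1}"
  shows "pathin X (path_segment p a b)"
proof -
  have "pathin X (p \<circ> (\<lambda>t. a + t * (b - a)))"
  proof (rule pathin_reparam)
    show "path_image (\<lambda>t. a + t * (b - a)) \<subseteq> {0..1}"
      unfolding path_image_def using convex_combination_in[OF assms(2,3)] by blast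
  qed (use assms in \<open>auto intro!: continuous_on_imp_path continuous_intros\<close>)
  then show ?thesis by (simp add: path_segment_def o_def)
qed

lemma path_homotopic_path_segment_then:
  assumes "pathin X p" "a \<in> {0..1}" "b \<in> {0..1}" "c \<in> {0..1}"
  shows "path_homotopic X (path_then (path_segment p a b) (path_segment p b c)) (path_segment p a c)"
proof (rule path_homotopic_common_reparam)
  \<comment> \<open>The reparametrisations are segments of the identity path of
    \<open>{0..1}\<close>, so the order of \<open>a\<close>, \<open>b\<close>, \<open>c\<close> does
    not matter.\<close>
  let ?f = "path_then (path_segment id a b) (path_segment id b c) :: real \<Rightarrow> real"
  let ?g = "path_segment id a c :: real \<Rightarrow> real"
  have id: "pathin (top_of_set {0..1}) (id :: real \<Rightarrow> real)"
    by (simp add: pathin_def)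
  have "pathin (top_of_set {0..1}) ?f" "pathin (top_of_set {0..1}) ?g"
    using assms by (auto intro!: pathin_path_then pathin_path_segment id)
  then show "path ?f" "path_image ?f \<subseteq> {0..1}" "path ?g" "path_image ?g \<subseteq> {0..1}"
    by (auto simp: pathin_def path_def path_image_def)
qed (use assms in \<open>auto simp: path_then_def path_segment_def\<close>)

section \<open>Groupoids with local sections\<close>

text \<open>Closure of the operations is postulated here instead of being derived from continuity.
  The cancellation rules thus become available for the fundamental groupoid before anything is known
  about its topology; \<open>good_set_base\<close> computes with them.\<close>

locale algebraic_groupoid =
  fixes G :: "('u, 'g) groupoid"
  assumes rng_in: "a \<in> topspace (arrows G) \<Longrightarrow> rng G a \<in> topspace (units G)"
    and src_in: "a \<in> topspace (arrows G) \<Longrightarrow> src G a \<in> topspace (units G)"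
    and unit_arrow_in: "u \<in> topspace (units G) \<Longrightarrow> unit_arrow G u \<in> topspace (arrows G)"
    and mult_arrow_in: "(a, b) \<in> composable G \<Longrightarrow> mult_arrow G a b \<in> topspace (arrows G)"
    and inv_arrow_in: "a \<in> topspace (arrows G) \<Longrightarrow> inv_arrow G a \<in> topspace (arrows G)"
    and unit_arrow_ends: "u \<in> topspace (units G) \<Longrightarrow>
      rng G (unit_arrow G u) = u \<and> src G (unit_arrow G u) = u"
    and mult_arrow_ends: "(a, b) \<in> composable G \<Longrightarrow>
      rng G (mult_arrow G a b) = rng G a \<and> src G (mult_arrow G a b) = src G b"
    and mult_arrow_assoc: "(a, b) \<in> composable G \<Longrightarrow> (b, c) \<in> composable G \<Longrightarrow>
      mult_arrow G (mult_arrow G a b) c = mult_arrow G a (mult_arrow G b c)"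
    and mult_unit_arrow: "a \<in> topspace (arrows G) \<Longrightarrow>
      mult_arrow G (unit_arrow G (rng G a)) a = a \<and> mult_arrow G a (unit_arrow G (src G a)) = a"
    and inv_arrow_ends: "a \<in> topspace (arrows G) \<Longrightarrow>
      rng G (inv_arrow G a) = src G a \<and> src G (inv_arrow G a) = rng G a"
    and mult_inv_arrow: "a \<in> topspace (arrows G) \<Longrightarrow>
      mult_arrow G a (inv_arrow G a) = unit_arrow G (rng G a) \<and>
      mult_arrow G (inv_arrow G a) a = unit_arrow G (src G a)"
begin

abbreviation arr :: "'g set" where "arr \<equiv> topspace (arrows G)"
abbreviation r :: "'g \<Rightarrow> 'u" where "r \<equiv> rng G"
abbreviation s :: "'g \<Rightarrow> 'u" where "s \<equiv> src G"
abbreviation mul :: "'g \<Rightarrow> 'g \<Rightarrow> 'g"  (infixr "\<cdot>" 70) where "a \<cdot> b \<equiv> mult_arrow G a b"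

lemma mul_closed [simp]:
  assumes "a \<in> arr" "b \<in> arr" "s a = r b"
  shows "a \<cdot> b \<in> arr" "r (a \<cdot> b) = r a" "s (a \<cdot> b) = s b"
  using assms mult_arrow_in[of a b] mult_arrow_ends[of a b] by (auto simp: composable_def)

lemma mul_assoc [simp]:
  assumes "a \<in> arr" "b \<in> arr" "c \<in> arr" "s a = r b" "s b = r c"
  shows "(a \<cdot> b) \<cdot> c = a \<cdot> b \<cdot> c"
  using assms mult_arrow_assoc[of a b c] by (auto simp: composable_def)

lemma unit_mul [simp]: "a \<in> arr \<Longrightarrow> unit_arrow G (r a) \<cdot> a = a"
  and mul_unit [simp]: "a \<in> arr \<Longrightarrow> a \<cdot> unit_arrow G (s a) = a"
  by (simp_all add: mult_unit_arrow)

lemma unit_mul_eq: "a \<in> arr \<Longrightarrow> r a = u \<Longrightarrow> unit_arrow G u \<cdot> a = a"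
  and mul_unit_eq: "a \<in> arr \<Longrightarrow> s a = u \<Longrightarrow> a \<cdot> unit_arrow G u = a"
  by (auto simp: mult_unit_arrow)

lemma inv_closed [simp]:
  assumes "a \<in> arr"
  shows "inv_arrow G a \<in> arr" "r (inv_arrow G a) = s a" "s (inv_arrow G a) = r a"
  using assms inv_arrow_in inv_arrow_ends by auto

lemma inv_mul_cancel:
  assumes "a \<in> arr" "b \<in> arr" "s a = r b"
  shows "inv_arrow G a \<cdot> (a \<cdot> b) = b"
  using assms mult_inv_arrow[of a] mul_assoc[of "inv_arrow G a" a b]
  by (simp add: unit_mul_eq)

lemma mul_inv_cancel:
  assumes "a \<in> arr" "b \<in> arr" "r a = r b"
  shows "a \<cdot> (inv_arrow G a \<cdot> b) = b"
  using assms mult_inv_arrow[of a] mul_assoc[of a "inv_arrow G a" b]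
  by (simp add: unit_mul_eq)

lemma inv_unique:
  assumes "a \<in> arr" "b \<in> arr" "s a = r b" "a \<cdot> b = unit_arrow G (r a)"
  shows "inv_arrow G a = b"
proof -
  have "inv_arrow G a \<cdot> (a \<cdot> b) = inv_arrow G a"
    using assms mul_unit[of "inv_arrow G a"] by simp
  then show ?thesis
    using inv_mul_cancel[of a b] assms by simp
qed

lemma inv_mul:
  assumes "a \<in> arr" "b \<in> arr" "s a = r b"
  shows "inv_arrow G (a \<cdot> b) = inv_arrow G b \<cdot> inv_arrow G a"
proof (rule inv_unique)
  show "(a \<cdot> b) \<cdot> (inv_arrow G b \<cdot> inv_arrow G a) = unit_arrow G (r (a \<cdot> b))"
    using assms mul_inv_cancel[of b "inv_arrow G a"] mult_inv_arrow[of a] by simp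
qed (use assms in auto)

lemma eq_if_inv_mul_eq_unit:
  assumes "a \<in> arr" "b \<in> arr" "r a = r b" "inv_arrow G b \<cdot> a = unit_arrow G (s b)"
  shows "a = b"
proof -
  have "b \<cdot> (inv_arrow G b \<cdot> a) = a" using assms by (intro mul_inv_cancel) auto
  then show ?thesis using assms by simp
qed

lemma mul_right_cancel:
  assumes "a \<in> arr" "b \<in> arr" "c \<in> arr" "s a = r c" "s b = r c" "a \<cdot> c = b \<cdot> c"
  shows "a = b"
proof -
  have *: "(x \<cdot> c) \<cdot> inv_arrow G c = x" if "x \<in> arr" "s x = r c" for x
    using that assms(3) mult_inv_arrow[of c] by (simp add: mul_unit_eq)
  show ?thesis using *[of a] *[of b] assms by simp
qed

end

text \<open>In the fundamental groupoid, \<open>good\<close> sets are the path connected open sets whose loops are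
  null homotopic in the whole space, and \<open>\<sigma> U y x\<close> is the class of any path from \<open>x\<close> to \<open>y\<close> in \<open>U\<close>.\<close>

locale sectional_groupoid = algebraic_groupoid G
  for G :: "('u, 'g) groupoid" +
  fixes good :: "'u set \<Rightarrow> bool" and \<sigma> :: "'u set \<Rightarrow> 'u \<Rightarrow> 'u \<Rightarrow> 'g"
  assumes good_open: "good U \<Longrightarrow> openin (units G) U"
    and good_base: "openin (units G) W \<Longrightarrow> x \<in> W \<Longrightarrow> \<exists>U. good U \<and> x \<in> U \<and> U \<subseteq> W"
    and \<sigma>_in: "good U \<Longrightarrow> x \<in> U \<Longrightarrow> y \<in> U \<Longrightarrow> \<sigma> U y x \<in> topspace (arrows G)"
    and rng_\<sigma>: "good U \<Longrightarrow> x \<in> U \<Longrightarrow> y \<in> U \<Longrightarrow> rng G (\<sigma> U y x) = y"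
    and src_\<sigma>: "good U \<Longrightarrow> x \<in> U \<Longrightarrow> y \<in> U \<Longrightarrow> src G (\<sigma> U y x) = x"
    and \<sigma>_mult: "good U \<Longrightarrow> x \<in> U \<Longrightarrow> y \<in> U \<Longrightarrow> z \<in> U \<Longrightarrow>
      mult_arrow G (\<sigma> U z y) (\<sigma> U y x) = \<sigma> U z x"
    and \<sigma>_mono: "good U \<Longrightarrow> good U' \<Longrightarrow> U' \<subseteq> U \<Longrightarrow> x \<in> U' \<Longrightarrow> y \<in> U' \<Longrightarrow> \<sigma> U' y x = \<sigma> U y x"
begin

lemmas \<sigma>_simps [simp] = \<sigma>_in rng_\<sigma> src_\<sigma> \<sigma>_mult

lemma good_subset: "good U \<Longrightarrow> U \<subseteq> topspace (units G)"
  by (simp add: good_open openin_subset)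

lemma \<sigma>_mult_left [simp]:
  assumes "good U" "y \<in> U" "z \<in> U" "a \<in> arr" "r a \<in> U" "y = r a" "x = z" "w \<in> U"
  shows "\<sigma> U w z \<cdot> \<sigma> U x y \<cdot> a = \<sigma> U w y \<cdot> a"
  using assms mul_assoc[of "\<sigma> U w z" "\<sigma> U z y" a] by simp

text \<open>A short loop is idempotent by \<open>\<sigma>_mult\<close>, and the only idempotents of
  a groupoid are its units.\<close>

lemma \<sigma>_refl:
  assumes "good U" "x \<in> U"
  shows "\<sigma> U x x = unit_arrow G x"
proof -
  let ?e = "\<sigma> U x x"
  have "inv_arrow G ?e \<cdot> (?e \<cdot> ?e) = ?e"
    using assms by (intro inv_mul_cancel) auto
  then show ?thesis
    using assms mult_inv_arrow[of ?e] by simp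
qed

lemma inv_\<sigma>:
  assumes "good U" "x \<in> U" "y \<in> U"
  shows "inv_arrow G (\<sigma> U y x) = \<sigma> U x y"
  using assms by (intro inv_unique) (auto simp: \<sigma>_refl)

section \<open>Sliding an arrow within a box\<close>

definition box :: "'g \<Rightarrow> 'u set \<Rightarrow> 'u set \<Rightarrow> bool" where
  "box g U V \<longleftrightarrow> g \<in> arr \<and> good U \<and> good V \<and> r g \<in> U \<and> s g \<in> V"

text \<open>\<open>nbr g U V\<close> is the basic open set \<open>N(g, U, V)\<close>, and \<open>slide g U V y x\<close> is its only arrow from \<open>x\<close>
  to \<open>y\<close>.\<close>

definition slide :: "'g \<Rightarrow> 'u set \<Rightarrow> 'u set \<Rightarrow> 'u \<Rightarrow> 'u \<Rightarrow> 'g" where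
  "slide g U V y x = \<sigma> U y (r g) \<cdot> g \<cdot> \<sigma> V (s g) x"

definition nbr :: "'g \<Rightarrow> 'u set \<Rightarrow> 'u set \<Rightarrow> 'g set" where
  "nbr g U V = {slide g U V y x | y x. y \<in> U \<and> x \<in> V}"

lemma slide_closed [simp]:
  assumes "box g U V" "y \<in> U" "x \<in> V"
  shows "slide g U V y x \<in> arr" "r (slide g U V y x) = y" "s (slide g U V y x) = x"
  using assms by (auto simp: slide_def box_def)

lemma slide_self:
  assumes "box g U V"
  shows "slide g U V (r g) (s g) = g"
  using assms by (auto simp: slide_def box_def \<sigma>_refl)

lemma box_slide:
  assumes "box g U V" "y \<in> U" "x \<in> V"
  shows "box (slide g U V y x) U V"
  using assms slide_closed[OF assms] by (auto simp: box_def)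

text \<open>Short arrows of \<open>U\<close> compose to short arrows of \<open>U\<close>, and
  likewise in \<open>V\<close>, so the intermediate ends \<open>y\<close> and \<open>x\<close> leave
  no trace: inside a box, transport has no monodromy.\<close>

lemma slide_slide:
  assumes "box g U V" "y \<in> U" "x \<in> V" "y' \<in> U" "x' \<in> V"
  shows "slide (slide g U V y x) U V y' x' = slide g U V y' x'"
  using assms by (simp add: slide_def box_def)

text \<open>By \<open>\<sigma>_mono\<close> transport does not depend on the size of the box. Slides
  in two overlapping boxes are always compared by passing to a smaller box inside both.\<close>

lemma slide_mono:
  assumes "box g U V" "box g U' V'" "U' \<subseteq> U" "V' \<subseteq> V" "y \<in> U'" "x \<in> V'"
  shows "slide g U' V' y x = slide g U V y x"
  using assms \<sigma>_mono[of U U' "r g" y] \<sigma>_mono[of V V' x "s g"] by (simp add: slide_def box_def)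

lemma slide_back:
  assumes "box g U V" "y \<in> U" "x \<in> V"
  shows "slide (slide g U V y x) U V (r g) (s g) = g"
  using slide_slide[OF assms, of "r g" "s g"] slide_self[OF assms(1)] assms(1)
  unfolding box_def by metis

text \<open>Sliding back recovers the arrow. Hence different arrows with the same ends have disjoint
  basic neighbourhoods over the same \<open>U\<close> and \<open>V\<close>, which is what the
  Hausdorff property comes down to.\<close>

lemma slide_inject:
  assumes "box g U V" "box h U V" "y \<in> U" "x \<in> V" "r g = r h" "s g = s h"
    and "slide g U V y x = slide h U V y x"
  shows "g = h"
proof -
  have "g = slide (slide g U V y x) U V (r g) (s g)"
    by (rule slide_back[OF assms(1,3,4), symmetric])
  also have "\<dots> = slide (slide h U V y x) U V (r h) (s h)"
    by (simp only: assms(5-7))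
  also have "\<dots> = h"
    by (rule slide_back[OF assms(2,3,4)])
  finally show ?thesis .
qed

text \<open>The two short arrows of \<open>W\<close> that meet in the middle are inverse to each
  other, so the product forgets the point \<open>z\<close>.\<close>

lemma slide_mul:
  assumes "box g U W" "box h W V" "s g = r h" "y \<in> U" "z \<in> W" "x \<in> V"
  shows "slide g U W y z \<cdot> slide h W V z x = slide (g \<cdot> h) U V y x"
proof -
  have "\<sigma> W (r h) z \<cdot> \<sigma> W z (r h) \<cdot> h \<cdot> \<sigma> V (s h) x = \<sigma> W (r h) (r h) \<cdot> h \<cdot> \<sigma> V (s h) x"
    using assms by (intro \<sigma>_mult_left) (auto simp: box_def)
  also have "\<dots> = h \<cdot> \<sigma> V (s h) x"
    using assms by (auto simp: box_def \<sigma>_refl unit_mul_eq)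
  finally show ?thesis
    using assms by (simp add: slide_def box_def)
qed

lemma inv_slide:
  assumes "box g U V" "y \<in> U" "x \<in> V"
  shows "inv_arrow G (slide g U V y x) = slide (inv_arrow G g) V U x y"
  using assms by (simp add: slide_def box_def inv_mul inv_\<sigma>)

lemma slide_unit:
  assumes "good U" "x \<in> U" "y \<in> U"
  shows "slide (unit_arrow G x) U U y y = unit_arrow G y"
proof -
  have "x \<in> topspace (units G)" using assms good_subset by auto
  then show ?thesis
    using assms unit_arrow_ends[of x] unit_arrow_in[of x]
    by (simp add: slide_def unit_mul_eq) (simp add: \<sigma>_refl)
qed

lemma \<sigma>_slide:
  assumes "box g U V" "y \<in> U" "x \<in> V" "z \<in> U"
  shows "\<sigma> U z y \<cdot> slide g U V y x = slide g U V z x"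
  using assms by (simp add: slide_def box_def)

lemma slide_\<sigma>_mul:
  assumes "box g U V" "y \<in> U" "x \<in> V" "z \<in> U"
  shows "slide (\<sigma> U z (r g) \<cdot> g) U V y x = slide g U V y x"
  using assms by (simp add: slide_def box_def)

lemma nbr_iff:
  assumes "box g U V"
  shows "h \<in> nbr g U V \<longleftrightarrow> r h \<in> U \<and> s h \<in> V \<and> h = slide g U V (r h) (s h)"
  using assms by (auto simp: nbr_def)

lemma nbr_self: "box g U V \<Longrightarrow> g \<in> nbr g U V"
  by (auto simp: nbr_iff slide_self box_def)

lemma nbr_subset_arr: "box g U V \<Longrightarrow> nbr g U V \<subseteq> arr"
  by (auto simp: nbr_def)

lemma box_of_nbr: "box g U V \<Longrightarrow> h \<in> nbr g U V \<Longrightarrow> box h U V"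
  by (auto simp: nbr_def box_slide)

text \<open>Any member of a basic set can serve as its centre, by \<open>slide_slide\<close>. So
  basic sets over the same \<open>U\<close> and \<open>V\<close> are equal or disjoint, and each of
  them is open.\<close>

lemma nbr_eq:
  assumes "box g U V" "h \<in> nbr g U V"
  shows "nbr h U V = nbr g U V"
proof -
  obtain y x where yx: "y \<in> U" "x \<in> V" "h = slide g U V y x"
    using assms by (auto simp: nbr_def)
  have "box h U V" using assms box_of_nbr by blast
  then show ?thesis
    using slide_slide[OF assms(1) yx(1,2)] yx(3) by (auto simp: nbr_iff assms(1))
qed

lemma nbr_mono:
  assumes "box g U V" "box g U' V'" "U' \<subseteq> U" "V' \<subseteq> V"
  shows "nbr g U' V' \<subseteq> nbr g U V"
proof
  fix h assume "h \<in> nbr g U' V'"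
  then have h: "r h \<in> U'" "s h \<in> V'" "h = slide g U' V' (r h) (s h)"
    using nbr_iff[OF assms(2)] by auto
  then have "h = slide g U V (r h) (s h)"
    using slide_mono[OF assms] by metis
  then show "h \<in> nbr g U V"
    using h assms nbr_iff[OF assms(1)] by blast
qed

lemma inj_on_nbr:
  assumes "box g U V"
  shows "inj_on (\<lambda>h. (r h, s h)) (nbr g U V)"
proof (rule inj_onI)
  fix h k assume *: "h \<in> nbr g U V" "k \<in> nbr g U V" "(r h, s h) = (r k, s k)"
  then show "h = k"
    using nbr_iff[OF assms] by (metis prod.inject)
qed

end

text \<open>Flat: near an arrow the groupoid looks like \<open>U \<times> V\<close>, an arrow being
  determined there by its two ends. All topological properties of the arrows are derived from this
  basis and from the properties of the unit space.\<close>

locale flat_groupoid = sectional_groupoid +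
  assumes openin_arrows_iff: "openin (arrows G) W \<longleftrightarrow>
      W \<subseteq> topspace (arrows G) \<and> (\<forall>g\<in>W. \<exists>U V. box g U V \<and> nbr g U V \<subseteq> W)"
    and Hausdorff_units: "Hausdorff_space (units G)"
    and locally_compact_units: "locally_compact_space (units G)"
begin

section \<open>A flat groupoid is a locally compact topological groupoid\<close>

lemma openin_nbr: "box g U V \<Longrightarrow> openin (arrows G) (nbr g U V)"
  unfolding openin_arrows_iff using nbr_subset_arr nbr_eq box_of_nbr by blast

lemma nbr_base:
  assumes "openin (arrows G) W" "g \<in> W" "openin (units G) A" "r g \<in> A" "openin (units G) B" "s g \<in> B"
  obtains U V where "box g U V" "nbr g U V \<subseteq> W" "U \<subseteq> A" "V \<subseteq> B"
proof -
  obtain U V where UV: "box g U V" "nbr g U V \<subseteq> W"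
    using assms openin_arrows_iff by blast
  have "openin (units G) (U \<inter> A)" "openin (units G) (V \<inter> B)"
    using UV assms by (auto simp: box_def good_open)
  moreover have "r g \<in> U \<inter> A" "s g \<in> V \<inter> B"
    using UV assms by (auto simp: box_def)
  ultimately obtain U' V' where *: "good U'" "r g \<in> U'" "U' \<subseteq> U \<inter> A" "good V'" "s g \<in> V'" "V' \<subseteq> V \<inter> B"
    using good_base by meson
  then have "box g U' V'"
    using UV by (auto simp: box_def)
  then show ?thesis
    using that[of U' V'] nbr_mono[OF UV(1), of U' V'] UV(2) * by blast
qed

lemma box_base:
  assumes "g \<in> arr" "openin (units G) A" "r g \<in> A" "openin (units G) B" "s g \<in> B"
  obtains U V where "box g U V" "U \<subseteq> A" "V \<subseteq> B"
  using nbr_base[of arr g A B] assms by (metis openin_topspace)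

lemma continuous_map_into_arrows:
  assumes "\<And>z. z \<in> topspace Z \<Longrightarrow> f z \<in> arr"
    and "\<And>z U V. z \<in> topspace Z \<Longrightarrow> box (f z) U V \<Longrightarrow>
      \<exists>T. openin Z T \<and> z \<in> T \<and> f ` T \<subseteq> nbr (f z) U V"
  shows "continuous_map Z (arrows G) f"
  unfolding continuous_map_def
proof (intro conjI allI impI)
  show "f \<in> topspace Z \<rightarrow> arr" using assms(1) by auto
  fix W assume W: "openin (arrows G) W"
  show "openin Z {x \<in> topspace Z. f x \<in> W}"
  proof (subst openin_subopen, safe)
    fix z assume z: "z \<in> topspace Z" "f z \<in> W"
    then obtain U V where UV: "box (f z) U V" "nbr (f z) U V \<subseteq> W"
      using W openin_arrows_iff by blast
    then obtain T where T: "openin Z T" "z \<in> T" "f ` T \<subseteq> nbr (f z) U V"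
      using assms(2)[OF z(1) UV(1)] by blast
    then show "\<exists>T. openin Z T \<and> z \<in> T \<and> T \<subseteq> {x \<in> topspace Z. f x \<in> W}"
      using UV openin_subset[OF T(1)] by (intro exI[of _ T]) auto
  qed
qed

lemma continuous_map_rng: "continuous_map (arrows G) (units G) r"
  unfolding continuous_map_def
proof (intro conjI allI impI)
  show "r \<in> arr \<rightarrow> topspace (units G)" using rng_in by auto
  fix A assume A: "openin (units G) A"
  show "openin (arrows G) {g \<in> arr. r g \<in> A}"
  proof (subst openin_arrows_iff, safe)
    fix g assume g: "g \<in> arr" "r g \<in> A"
    obtain U V where *: "box g U V" "U \<subseteq> A"
      by (rule box_base[OF g(1) A g(2) openin_topspace src_in[OF g(1)]])
    have "nbr g U V \<subseteq> {g \<in> arr. r g \<in> A}"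
      using nbr_iff[OF *(1)] nbr_subset_arr[OF *(1)] *(2) by auto
    with *(1) show "\<exists>U V. box g U V \<and> nbr g U V \<subseteq> {g \<in> arr. r g \<in> A}"
      by blast
  qed
qed

lemma continuous_map_src: "continuous_map (arrows G) (units G) s"
  unfolding continuous_map_def
proof (intro conjI allI impI)
  show "s \<in> arr \<rightarrow> topspace (units G)" using src_in by auto
  fix A assume A: "openin (units G) A"
  show "openin (arrows G) {g \<in> arr. s g \<in> A}"
  proof (subst openin_arrows_iff, safe)
    fix g assume g: "g \<in> arr" "s g \<in> A"
    obtain U V where *: "box g U V" "V \<subseteq> A"
      by (rule box_base[OF g(1) openin_topspace rng_in[OF g(1)] A g(2)])
    have "nbr g U V \<subseteq> {g \<in> arr. s g \<in> A}"
      using nbr_iff[OF *(1)] nbr_subset_arr[OF *(1)] *(2) by auto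
    with *(1) show "\<exists>U V. box g U V \<and> nbr g U V \<subseteq> {g \<in> arr. s g \<in> A}"
      by blast
  qed
qed

lemma continuous_map_unit: "continuous_map (units G) (arrows G) (unit_arrow G)"
proof (rule continuous_map_into_arrows)
  fix z U V assume z: "z \<in> topspace (units G)" and UV: "box (unit_arrow G z) U V"
  then have "z \<in> U \<inter> V" "openin (units G) (U \<inter> V)"
    using unit_arrow_ends by (auto simp: box_def good_open)
  then obtain C where C: "good C" "z \<in> C" "C \<subseteq> U \<inter> V"
    using good_base by blast
  have "box (unit_arrow G z) C C"
    using UV C z unit_arrow_ends[of z] by (auto simp: box_def)
  then have "nbr (unit_arrow G z) C C \<subseteq> nbr (unit_arrow G z) U V"
    using C UV by (intro nbr_mono) auto
  moreover have "unit_arrow G ` C \<subseteq> nbr (unit_arrow G z) C C"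
    using slide_unit[OF C(1,2)] by (force simp: nbr_def)
  ultimately show "\<exists>T. openin (units G) T \<and> z \<in> T \<and> unit_arrow G ` T \<subseteq> nbr (unit_arrow G z) U V"
    using C good_open by blast
qed (rule unit_arrow_in)

lemma continuous_map_inv: "continuous_map (arrows G) (arrows G) (inv_arrow G)"
proof (rule continuous_map_into_arrows)
  fix g U V assume g: "g \<in> arr" and UV: "box (inv_arrow G g) U V"
  then have VU: "box g V U" by (auto simp: box_def)
  have "inv_arrow G ` nbr g V U \<subseteq> nbr (inv_arrow G g) U V"
    using inv_slide[OF VU] by (force simp: nbr_def)
  then show "\<exists>T. openin (arrows G) T \<and> g \<in> T \<and> inv_arrow G ` T \<subseteq> nbr (inv_arrow G g) U V"
    using openin_nbr[OF VU] nbr_self[OF VU] by blast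
qed simp

lemma continuous_map_mul:
  "continuous_map (subtopology (prod_topology (arrows G) (arrows G)) (composable G)) (arrows G)
     (\<lambda>(a, b). a \<cdot> b)"
proof (rule continuous_map_into_arrows)
  let ?Z = "subtopology (prod_topology (arrows G) (arrows G)) (composable G)"
  fix z assume z: "z \<in> topspace ?Z"
  then obtain a b where ab: "z = (a, b)" "a \<in> arr" "b \<in> arr" "s a = r b"
    by (auto simp: composable_def)
  then show "(case z of (a, b) \<Rightarrow> a \<cdot> b) \<in> arr" by simp
  fix U V assume "box (case z of (a, b) \<Rightarrow> a \<cdot> b) U V"
  then have UV: "box (a \<cdot> b) U V" using ab by simp
  \<comment> \<open>Any good set around the common end will do, since \<open>slide_mul\<close> gives
    the same result for every middle point in it.\<close>
  obtain C where C: "good C" "r b \<in> C"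
    using good_base[OF openin_topspace rng_in[OF ab(3)]] by blast
  have boxes: "box a U C" "box b C V"
    using UV C ab by (auto simp: box_def)
  let ?T = "(nbr a U C \<times> nbr b C V) \<inter> composable G"
  have "openin ?Z ?T"
    by (intro openin_subtopology_Int) (simp add: openin_prod_Times_iff openin_nbr boxes)
  moreover have "z \<in> ?T"
    using ab nbr_self[OF boxes(1)] nbr_self[OF boxes(2)] by (simp add: composable_def)
  moreover have "(\<lambda>(a, b). a \<cdot> b) ` ?T \<subseteq> nbr (a \<cdot> b) U V"
  proof clarify
    fix a' b' assume *: "a' \<in> nbr a U C" "b' \<in> nbr b C V" "(a', b') \<in> composable G"
    have a': "r a' \<in> U" "s a' \<in> C" "a' = slide a U C (r a') (s a')"
      using *(1) nbr_iff[OF boxes(1)] by blast+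
    have b': "s b' \<in> V" "b' = slide b C V (r b') (s b')"
      using *(2) nbr_iff[OF boxes(2)] by blast+
    have "s a' = r b'" using *(3) by (simp add: composable_def)
    then have "a' \<cdot> b' = slide (a \<cdot> b) U V (r a') (s b')"
      using slide_mul[OF boxes ab(4) a'(1,2) b'(1)] a'(3) b'(2) by metis
    then show "a' \<cdot> b' \<in> nbr (a \<cdot> b) U V"
      using a'(1) b'(1) by (auto simp: nbr_def)
  qed
  ultimately show "\<exists>T. openin ?Z T \<and> z \<in> T \<and>
      (\<lambda>(a, b). a \<cdot> b) ` T \<subseteq> nbr (case z of (a, b) \<Rightarrow> a \<cdot> b) U V"
    using ab by auto
qed

text \<open>If the two arrows differ in range or source, a separation in the unit space is pulled
  back along \<open>r\<close> or \<open>s\<close>. Parallel arrows are separated by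
  \<open>slide_inject\<close>.\<close>

lemma Hausdorff_arr: "Hausdorff_space (arrows G)"
  unfolding Hausdorff_space_def
proof (intro allI impI, elim conjE)
  fix g h assume g: "g \<in> arr" and h: "h \<in> arr" and ne: "g \<noteq> h"
  let ?sep = "\<exists>U V. openin (arrows G) U \<and> openin (arrows G) V \<and> g \<in> U \<and> h \<in> V \<and> disjnt U V"
  have separate: ?sep if f: "continuous_map (arrows G) (units G) f" "f g \<noteq> f h" for f
  proof -
    have "f g \<in> topspace (units G)" "f h \<in> topspace (units G)"
      using f(1) g h by (auto simp: continuous_map_def)
    then obtain A B where "openin (units G) A" "openin (units G) B" "f g \<in> A" "f h \<in> B" "disjnt A B"
      using Hausdorff_units f(2) unfolding Hausdorff_space_def by metis
    then show ?thesis
      using f(1) g h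
      by (intro exI[of _ "{x \<in> arr. f x \<in> A}"] exI[of _ "{x \<in> arr. f x \<in> B}"])
        (auto simp: disjnt_iff openin_continuous_map_preimage)
  qed
  show ?sep
  proof (cases "r g = r h \<and> s g = s h")
    case True
    obtain U V where g_box: "box g U V"
      by (rule box_base[OF g openin_topspace rng_in[OF g] openin_topspace src_in[OF g]])
    then have h_box: "box h U V" using True h by (auto simp: box_def)
    have "disjnt (nbr g U V) (nbr h U V)"
      unfolding disjnt_iff using slide_inject[OF g_box h_box] True ne
      by (metis nbr_iff[OF g_box] nbr_iff[OF h_box])
    then show ?thesis
      using openin_nbr[OF g_box] nbr_self[OF g_box] openin_nbr[OF h_box] nbr_self[OF h_box] by blast
  next
    case False
    then show ?thesis
      using separate continuous_map_rng continuous_map_src by blast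
  qed
qed

text \<open>This is the inverse of the chart \<open>(r, s)\<close>. It carries compact products to
  compact sets of arrows and makes translates of an arrow depend continuously on its ends.\<close>

lemma continuous_map_slide:
  assumes "box g U V"
  shows "continuous_map (subtopology (prod_topology (units G) (units G)) (U \<times> V)) (arrows G)
     (\<lambda>(y, x). slide g U V y x)"
proof (rule continuous_map_into_arrows)
  let ?Z = "subtopology (prod_topology (units G) (units G)) (U \<times> V)"
  fix z assume "z \<in> topspace ?Z"
  then obtain y x where yx: "z = (y, x)" "y \<in> U" "x \<in> V" by auto
  then show "(case z of (y, x) \<Rightarrow> slide g U V y x) \<in> arr" using assms by simp
  fix A B assume "box (case z of (y, x) \<Rightarrow> slide g U V y x) A B"
  then have AB: "box (slide g U V y x) A B" using yx by simp
  have UV: "box (slide g U V y x) U V" using assms yx by (simp add: box_slide)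
  obtain U' V' where UV': "box (slide g U V y x) U' V'" "U' \<subseteq> U \<inter> A" "V' \<subseteq> V \<inter> B"
  proof (rule box_base)
    show "openin (units G) (U \<inter> A)" "openin (units G) (V \<inter> B)"
      "slide g U V y x \<in> arr" "r (slide g U V y x) \<in> U \<inter> A" "s (slide g U V y x) \<in> V \<inter> B"
      using UV AB by (auto simp: box_def good_open)
  qed
  have "(\<lambda>(y, x). slide g U V y x) ` (U' \<times> V') \<subseteq> nbr (slide g U V y x) A B"
  proof clarify
    fix y' x' assume *: "y' \<in> U'" "x' \<in> V'"
    \<comment> \<open>The centre is moved to the arrow at \<open>(y, x)\<close>; then the slides
      over \<open>U\<close>, \<open>V\<close> and over \<open>A\<close>, \<open>B\<close> are both
      identified with the one over the smaller sets \<open>U'\<close>, \<open>V'\<close>.\<close>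
    then have "slide g U V y' x' = slide (slide g U V y x) U V y' x'"
      using UV' yx assms by (subst slide_slide) auto
    also have "\<dots> = slide (slide g U V y x) U' V' y' x'"
      using UV UV' * by (intro slide_mono[symmetric]) auto
    also have "\<dots> = slide (slide g U V y x) A B y' x'"
      using AB UV' * by (intro slide_mono) auto
    finally show "slide g U V y' x' \<in> nbr (slide g U V y x) A B"
      using * UV' unfolding nbr_def by blast
  qed
  moreover have "openin ?Z (U' \<times> V')"
  proof -
    have "openin ?Z ((U' \<times> V') \<inter> (U \<times> V))"
      using UV' by (intro openin_subtopology_Int) (simp add: openin_prod_Times_iff box_def good_open)
    moreover have "(U' \<times> V') \<inter> (U \<times> V) = U' \<times> V'"
      using UV' by auto
    ultimately show ?thesis by simp
  qed
  moreover have "z \<in> U' \<times> V'"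
    using UV' yx assms by (auto simp: box_def)
  ultimately show "\<exists>T. openin ?Z T \<and> z \<in> T \<and>
      (\<lambda>(y, x). slide g U V y x) ` T \<subseteq> nbr (case z of (y, x) \<Rightarrow> slide g U V y x) A B"
    using yx by auto
qed

text \<open>Compact neighbourhoods \<open>K\<close> and \<open>L\<close> of the two ends, chosen
  inside the good sets, give the compact neighbourhood of all slides of \<open>g\<close> with ends
  in \<open>K \<times> L\<close>.\<close>

lemma locally_compact_arr: "locally_compact_space (arrows G)"
  unfolding locally_compact_space_def
proof
  fix g assume g: "g \<in> arr"
  obtain U V where UV: "box g U V"
    by (rule box_base[OF g openin_topspace rng_in[OF g] openin_topspace src_in[OF g]])
  have compact_nbhd: "\<exists>A K. openin (units G) A \<and> compactin (units G) K \<and> x \<in> A \<and> A \<subseteq> K \<and> K \<subseteq> U"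
    if "good U" "x \<in> U" for U x
  proof -
    have "neighbourhood_base_of (\<lambda>C. compactin (units G) C \<and> closedin (units G) C) (units G)"
      using locally_compact_space_neighbourhood_base_closedin[of "units G"]
        Hausdorff_units locally_compact_units by blast
    then show ?thesis
      using that good_open[OF that(1)] unfolding neighbourhood_base_of by metis
  qed
  obtain A K where A: "openin (units G) A" "compactin (units G) K" "r g \<in> A" "A \<subseteq> K" "K \<subseteq> U"
    using compact_nbhd[of U "r g"] UV by (auto simp: box_def)
  obtain B L where B: "openin (units G) B" "compactin (units G) L" "s g \<in> B" "B \<subseteq> L" "L \<subseteq> V"
    using compact_nbhd[of V "s g"] UV by (auto simp: box_def)
  let ?W = "nbr g U V \<inter> {h \<in> arr. r h \<in> A} \<inter> {h \<in> arr. s h \<in> B}"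
  let ?C = "(\<lambda>(y, x). slide g U V y x) ` (K \<times> L)"
  have "openin (arrows G) ?W"
    using A B UV continuous_map_rng continuous_map_src
    by (intro openin_Int openin_nbr openin_continuous_map_preimage)
  moreover have "compactin (arrows G) ?C"
  proof (rule image_compactin[OF _ continuous_map_slide[OF UV]])
    show "compactin (subtopology (prod_topology (units G) (units G)) (U \<times> V)) (K \<times> L)"
      using A B by (auto simp: compactin_subtopology compactin_Times)
  qed
  moreover have "g \<in> ?W"
    using g UV A B nbr_self by auto
  moreover have "?W \<subseteq> ?C"
  proof
    fix h assume "h \<in> ?W"
    then have "h = slide g U V (r h) (s h)" "r h \<in> K" "s h \<in> L"
      using nbr_iff[OF UV] A B by auto
    then show "h \<in> ?C" by (auto intro!: image_eqI[of _ _ "(r h, s h)"])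
  qed
  ultimately show "\<exists>U K. openin (arrows G) U \<and> compactin (arrows G) K \<and> g \<in> U \<and> U \<subseteq> K"
    by blast
qed

lemma locally_compact: "locally_compact_groupoid G"
proof unfold_locales
qed (use continuous_map_rng continuous_map_src continuous_map_unit continuous_map_mul
    continuous_map_inv unit_arrow_ends mult_arrow_ends mult_arrow_assoc mult_unit_arrow
    inv_arrow_ends mult_inv_arrow locally_compact_arr Hausdorff_arr in \<open>simp_all\<close>)

end

section \<open>Atomic Radon measures\<close>

definition borel_of_top :: "'a topology \<Rightarrow> 'a measure" where
  "borel_of_top T = sigma (topspace T) {U. openin T U}"

lemma space_borel_of_top [simp]: "space (borel_of_top T) = topspace T"
  by (simp add: borel_of_top_def space_measure_of_conv)

lemma sets_borel_of_top: "sets (borel_of_top T) = sigma_sets (topspace T) {U. openin T U}"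
  unfolding borel_of_top_def by (rule sets_measure_of) (auto dest: openin_subset)

lemma openin_sets_borel_of_top: "openin T U \<Longrightarrow> U \<in> sets (borel_of_top T)"
  by (simp add: sets_borel_of_top sigma_sets.Basic)

lemma closedin_sets_borel_of_top:
  assumes "closedin T C"
  shows "C \<in> sets (borel_of_top T)"
proof -
  have "topspace T - (topspace T - C) = C"
    using closedin_subset[OF assms] by blast
  then show ?thesis
    using sets.compl_sets[OF openin_sets_borel_of_top[of T "topspace T - C"]] assms
    by (simp add: openin_diff)
qed

lemma borel_measurable_continuous_map:
  fixes f :: "'a \<Rightarrow> 'b::topological_space"
  assumes "continuous_map T euclidean f"
  shows "f \<in> borel_measurable (borel_of_top T)"
proof (rule borel_measurableI)
  fix S :: "'b set" assume "open S"
  then have "openin T {x \<in> topspace T. f x \<in> S}"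
    using assms by (simp add: openin_continuous_map_preimage)
  then show "f -` S \<inter> space (borel_of_top T) \<in> sets (borel_of_top T)"
    using openin_sets_borel_of_top by (simp add: vimage_def Int_def conj_commute)
qed

text \<open>The integrand \<open>f (a \<cdot> h)\<close> of the invariance law is known to be
  continuous only on a closed fibre; the set integral extends it by zero.\<close>

lemma borel_measurable_continuous_map_closedin:
  fixes f :: "'a \<Rightarrow> 'b::real_normed_vector"
  assumes C: "closedin T C" and f: "continuous_map (subtopology T C) euclidean f"
  shows "(\<lambda>x. indicator C x *\<^sub>R f x) \<in> borel_measurable (borel_of_top T)"
proof (rule borel_measurableI)
  fix S :: "'b set" assume "open S"
  then have "openin (subtopology T C) {x \<in> topspace (subtopology T C). f x \<in> S}"
    using f by (intro openin_continuous_map_preimage) auto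
  then obtain W where W: "openin T W" "{x \<in> topspace (subtopology T C). f x \<in> S} = W \<inter> C"
    unfolding openin_subtopology by blast
  \<comment> \<open>Off \<open>C\<close> the function is 0, so the complement of \<open>C\<close>
    belongs to the preimage exactly when \<open>0 \<in> S\<close>.\<close>
  have "(\<lambda>x. indicator C x *\<^sub>R f x) -` S \<inter> space (borel_of_top T) =
      W \<inter> C \<union> (if 0 \<in> S then topspace T - C else {})"
    unfolding W(2)[symmetric] using closedin_subset[OF C]
    by (auto simp: indicator_def of_bool_def split: if_splits)
  moreover have "W \<inter> C \<union> (if 0 \<in> S then topspace T - C else {}) \<in> sets (borel_of_top T)"
    using openin_sets_borel_of_top[OF W(1)] closedin_sets_borel_of_top[OF C]
      sets.top[of "borel_of_top T"] by auto
  ultimately show "(\<lambda>x. indicator C x *\<^sub>R f x) -` S \<inter> space (borel_of_top T) \<in> sets (borel_of_top T)"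
    by simp
qed

text \<open>The density lives on all subsets of \<open>A\<close>; pushing it forward along the
  identity turns it into a measure on the Borel sets of \<open>T\<close> whose integrals are still
  sums over \<open>A\<close>.\<close>

definition atomic_measure :: "'a topology \<Rightarrow> 'a set \<Rightarrow> ('a \<Rightarrow> real) \<Rightarrow> 'a measure" where
  "atomic_measure T A w = distr (density (count_space A) w) (borel_of_top T) id"

lemma space_atomic_measure [simp]: "space (atomic_measure T A w) = topspace T"
  and sets_atomic_measure: "sets (atomic_measure T A w) = sets (borel_of_top T)"
  by (simp_all add: atomic_measure_def)

lemma measurable_id_count_space:
  "A \<subseteq> topspace T \<Longrightarrow> id \<in> measurable (density (count_space A) w) (borel_of_top T)"
  by (simp add: measurable_density_eq1 subset_iff)

lemma emeasure_atomic_measure: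
  assumes "A \<subseteq> topspace T" "B \<in> sets (borel_of_top T)"
  shows "emeasure (atomic_measure T A w) B = emeasure (density (count_space A) w) (A \<inter> B)"
  unfolding atomic_measure_def using assms
  by (subst emeasure_distr) (auto intro!: measurable_id_count_space simp: Int_commute)

lemma integral_atomic_measure:
  fixes f :: "'a \<Rightarrow> 'b::{banach, second_countable_topology}"
  assumes "A \<subseteq> topspace T" "f \<in> borel_measurable (borel_of_top T)" "\<And>x. 0 \<le> w x"
  shows "integral\<^sup>L (atomic_measure T A w) f = integral\<^sup>L (count_space A) (\<lambda>x. w x *\<^sub>R f x)"
  unfolding atomic_measure_def
  using assms by (subst integral_distr) (auto intro!: measurable_id_count_space integral_density)

lemma emeasure_density_count_space:
  assumes "B \<subseteq> A"
  shows "emeasure (density (count_space A) w) B = (\<integral>\<^sup>+x. w x \<partial>count_space B)"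
proof -
  have "emeasure (density (count_space A) w) B = (\<integral>\<^sup>+x. w x * indicator B x \<partial>count_space A)"
    using assms by (intro emeasure_density) auto
  also have "\<dots> = (\<integral>\<^sup>+x. w x \<partial>count_space B)"
    using assms by (auto simp: nn_integral_restrict_space[symmetric] restrict_count_space inf.absorb1)
  finally show ?thesis .
qed

text \<open>Finite initial parts of an enumeration exhaust \<open>B\<close>, so continuity from
  below applies. Finite sets being compact, this is the inner regularity of an atomic measure; it
  also yields the small tails below.\<close>

lemma emeasure_countable_approx:
  assumes M: "sets M = Pow A" and B: "B \<subseteq> A" "countable B" and less: "c < emeasure M B"
  shows "\<exists>F. finite F \<and> F \<subseteq> B \<and> c < emeasure M F"
proof -
  have ne: "B \<noteq> {}" using less by auto
  define F where "F n = from_nat_into B ` {..n}" for n :: nat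
  have "(\<Union>n. F n) = B"
  proof -
    have "(\<Union>n. F n) = range (from_nat_into B)" by (auto simp: F_def)
    then show ?thesis using range_from_nat_into[OF ne B(2)] by simp
  qed
  moreover have "(SUP n. emeasure M (F n)) = emeasure M (\<Union>n. F n)"
  proof (rule SUP_emeasure_incseq)
    show "range F \<subseteq> sets M"
      using B ne from_nat_into[OF ne] by (auto simp: F_def M)
    show "incseq F"
      by (auto simp: F_def incseq_def)
  qed
  ultimately obtain n where "c < emeasure M (F n)"
    using less by (metis less_SUP_iff)
  then show ?thesis
    using from_nat_into[OF ne] by (intro exI[of _ "F n"]) (auto simp: F_def)
qed

lemma emeasure_countable_tail:
  assumes M: "sets M = Pow A" and B: "B \<subseteq> A" "countable B"
    and fin: "emeasure M B < \<infinity>" and "(0::real) < e"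
  shows "\<exists>F. finite F \<and> F \<subseteq> B \<and> emeasure M (B - F) \<le> ennreal e"
proof (cases "emeasure M B = 0")
  case True
  then show ?thesis by (intro exI[of _ "{}"]) auto
next
  case False
  then have "emeasure M B - ennreal e < emeasure M B"
    using fin \<open>0 < e\<close>
    by (cases "emeasure M B" rule: ennreal_cases) (auto simp: ennreal_minus intro!: ennreal_lessI)
  then obtain F where F: "finite F" "F \<subseteq> B" "emeasure M B - ennreal e < emeasure M F"
    using emeasure_countable_approx[OF M B] by blast
  have "emeasure M (B - F) = emeasure M B - emeasure M F"
    using F B fin emeasure_mono[of F B M] by (intro emeasure_Diff) (auto simp: M)
  also have "\<dots> \<le> ennreal e"
    using F(3) fin
    by (cases "emeasure M B"; cases "emeasure M F") (auto simp: ennreal_minus ennreal_less_iff ennreal_le_iff2 \<open>0 < e\<close> order_less_imp_le)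
  finally show ?thesis using F by blast
qed

text \<open>The cover \<open>\<N>\<close> provides what a \<sigma>-compact space would: finite
  subcovers bound the mass of compact sets, and its countability lets the error of an outer
  approximation be distributed over its members.\<close>

lemma radon_atomic_measure:
  assumes T: "Hausdorff_space T" and A: "A \<subseteq> topspace T" "countable A"
    and \<N>: "countable \<N>" "\<And>N. N \<in> \<N> \<Longrightarrow> openin T N" "topspace T \<subseteq> \<Union>\<N>"
      "\<And>N. N \<in> \<N> \<Longrightarrow> (\<integral>\<^sup>+x. w x \<partial>count_space (A \<inter> N)) < \<infinity>"
  shows "radon_measure T (atomic_measure T A w)"
proof -
  let ?P = "density (count_space A) (\<lambda>x. ennreal (w x))"
  let ?M = "atomic_measure T A w"
  have P: "sets ?P = Pow A" by simp
  have em: "emeasure ?M B = emeasure ?P (A \<inter> B)" if "B \<in> sets (borel_of_top T)" for B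
    using emeasure_atomic_measure[OF A(1) that] .
  have em_open: "emeasure ?M B = emeasure ?P (A \<inter> B)" if "openin T B" for B
    using em[OF openin_sets_borel_of_top[OF that]] .
  have em_compact: "emeasure ?M B = emeasure ?P (A \<inter> B)" if "compactin T B" for B
    using em[OF closedin_sets_borel_of_top] compactin_imp_closedin[OF T that] by blast
  have finN: "emeasure ?P (A \<inter> N) < \<infinity>" if "N \<in> \<N>" for N
    using \<N>(4)[OF that] emeasure_density_count_space[of "A \<inter> N" A] by simp
  have compact_finite: "emeasure ?M K < \<infinity>" if K: "compactin T K" for K
  proof -
    obtain \<F> where \<F>: "finite \<F>" "\<F> \<subseteq> \<N>" "K \<subseteq> \<Union>\<F>"
      using K \<N>(2,3) unfolding compactin_def by (metis subset_trans)
    have "emeasure ?M K = emeasure ?P (A \<inter> K)"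
      using em_compact[OF K] .
    also have "\<dots> \<le> emeasure ?P (\<Union>N\<in>\<F>. A \<inter> N)"
      using \<F> by (intro emeasure_mono) auto
    also have "\<dots> \<le> (\<Sum>N\<in>\<F>. emeasure ?P (A \<inter> N))"
      using \<F> by (intro emeasure_subadditive_finite) auto
    also have "\<dots> < \<infinity>"
      using \<F> finN by (auto simp: less_top[symmetric])
    finally show ?thesis .
  qed
  have outer: "emeasure ?M B = (INF U \<in> {U. openin T U \<and> B \<subseteq> U}. emeasure ?M U)"
    if B: "B \<in> sets ?M" for B
  proof (rule antisym)
    show "emeasure ?M B \<le> (INF U \<in> {U. openin T U \<and> B \<subseteq> U}. emeasure ?M U)"
      by (intro INF_greatest emeasure_mono) (auto simp: sets_atomic_measure openin_sets_borel_of_top)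
    have Bs: "B \<in> sets (borel_of_top T)" using B by (simp add: sets_atomic_measure)
    have Bt: "B \<subseteq> topspace T" using sets.sets_into_space[OF Bs] by simp
    show "(INF U \<in> {U. openin T U \<and> B \<subseteq> U}. emeasure ?M U) \<le> emeasure ?M B"
    proof (cases "\<N> = {}")
      case True
      then have "B = {}" using \<N>(3) Bt by auto
      then show ?thesis
        by (intro INF_lower2[of "{}"]) auto
    next
      case False
      define N where "N = from_nat_into \<N>"
      have N: "N i \<in> \<N>" for i
        unfolding N_def using from_nat_into[OF False] .
      have cover: "topspace T \<subseteq> (\<Union>i. N i)"
        using \<N>(3) range_from_nat_into[OF False \<N>(1)] unfolding N_def by auto
      show ?thesis
      proof (rule ennreal_le_epsilon)
        fix e :: real assume "0 < e"
        \<comment> \<open>\<open>F i\<close> takes up all but a small mass of those atoms of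
          \<open>N i\<close> that lie outside \<open>B\<close>; the allowances
          \<open>e * (1/2) ^ Suc i\<close> add up to \<open>e\<close>.\<close>
        have "\<exists>F. finite F \<and> F \<subseteq> A \<inter> N i - B \<and>
            emeasure ?P ((A \<inter> N i - B) - F) \<le> ennreal (e * (1/2) ^ Suc i)" for i
        proof (rule emeasure_countable_tail[OF P])
          have "emeasure ?P (A \<inter> N i - B) \<le> emeasure ?P (A \<inter> N i)"
            by (intro emeasure_mono) auto
          then show "emeasure ?P (A \<inter> N i - B) < \<infinity>"
            using finN[OF N[of i]] by (rule order.strict_trans1)
          show "countable (A \<inter> N i - B)" using A by auto
        qed (use \<open>0 < e\<close> in auto)
        then obtain F where F: "\<And>i. finite (F i)" "\<And>i. F i \<subseteq> A \<inter> N i - B"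
          "\<And>i. emeasure ?P ((A \<inter> N i - B) - F i) \<le> ennreal (e * (1/2) ^ Suc i)"
          by metis
        \<comment> \<open>Finite sets are closed in a Hausdorff space, so removing
          \<open>F i\<close> keeps \<open>N i\<close> open, and no removed point belongs to
          \<open>B\<close>.\<close>
        define U where "U = (\<Union>i. N i - F i)"
        have "openin T (N i - F i)" for i
          using \<N>(2)[OF N] F A(1) closedin_Hausdorff_finite[OF T _ F(1)[of i]]
          by (intro openin_diff) blast+
        then have U: "openin T U" by (auto simp: U_def)
        have BU: "B \<subseteq> U"
        proof
          fix x assume "x \<in> B"
          moreover obtain i where "x \<in> N i" using cover Bt \<open>x \<in> B\<close> by blast
          ultimately show "x \<in> U" using F(2)[of i] by (auto simp: U_def)
        qed
        have "emeasure ?M U = emeasure ?P (A \<inter> U)" using em_open[OF U] .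
        also have "\<dots> \<le> emeasure ?P ((A \<inter> B) \<union> (\<Union>i. (A \<inter> N i - B) - F i))"
          by (intro emeasure_mono) (auto simp: U_def)
        also have "\<dots> \<le> emeasure ?P (A \<inter> B) + emeasure ?P (\<Union>i. (A \<inter> N i - B) - F i)"
          by (intro emeasure_subadditive) auto
        also have "emeasure ?P (\<Union>i. (A \<inter> N i - B) - F i) \<le> (\<Sum>i. emeasure ?P ((A \<inter> N i - B) - F i))"
          by (intro emeasure_subadditive_countably) auto
        also have "\<dots> \<le> (\<Sum>i. ennreal (e * (1/2) ^ Suc i))"
          using F(3) by (intro suminf_le) auto
        also have "\<dots> = ennreal (e * 1)"
          using \<open>0 < e\<close> by (intro suminf_ennreal_eq sums_mult power_half_series) auto
        finally have "emeasure ?M U \<le> emeasure ?M B + ennreal e"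
          by (simp add: em[OF Bs])
        then show "(INF U \<in> {U. openin T U \<and> B \<subseteq> U}. emeasure ?M U) \<le> emeasure ?M B + ennreal e"
          using U BU by (intro INF_lower2[of U]) auto
      qed
    qed
  qed
  have inner: "emeasure ?M U = (SUP K \<in> {K. compactin T K \<and> K \<subseteq> U}. emeasure ?M K)"
    if U: "openin T U" for U
  proof (rule antisym)
    show "(SUP K \<in> {K. compactin T K \<and> K \<subseteq> U}. emeasure ?M K) \<le> emeasure ?M U"
      using U by (intro SUP_least emeasure_mono) (auto simp: sets_atomic_measure openin_sets_borel_of_top)
    show "emeasure ?M U \<le> (SUP K \<in> {K. compactin T K \<and> K \<subseteq> U}. emeasure ?M K)"
    proof (rule le_SUP_iff[THEN iffD2], intro allI impI)
      fix c assume "c < emeasure ?M U"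
      then have "c < emeasure ?P (A \<inter> U)" using em_open[OF U] by simp
      then obtain F where F: "finite F" "F \<subseteq> A \<inter> U" "c < emeasure ?P F"
        using emeasure_countable_approx[OF P, of "A \<inter> U" c] A by auto
      then have "compactin T F"
        using A(1) by (intro finite_imp_compactin) auto
      moreover have "A \<inter> F = F" using F by auto
      ultimately show "\<exists>K\<in>{K. compactin T K \<and> K \<subseteq> U}. c < emeasure ?M K"
        using F em_compact by (intro bexI[of _ F]) auto
    qed
  qed
  show ?thesis
    unfolding radon_measure_def
    using compact_finite outer inner by (simp add: sets_atomic_measure sets_borel_of_top)
qed

section \<open>The Haar system of a flat groupoid\<close>

lemma integral_count_space_eq_infsum:
  fixes f :: "'a \<Rightarrow> 'b::{banach, second_countable_topology}"
  assumes "(\<lambda>x. norm (f x)) summable_on A"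
  shows "integral\<^sup>L (count_space A) f = infsum f A"
  using infsetsum_infsum[of f A] assms abs_summable_equivalent[of f A] by (simp add: infsetsum_def)

lemma summable_on_finite_Union:
  fixes f :: "'a \<Rightarrow> 'b::banach"
  assumes "finite \<A>" "\<And>A. A \<in> \<A> \<Longrightarrow> f summable_on A"
  shows "f summable_on \<Union>\<A>"
  using assms
proof (induction \<A>)
  case (insert A \<A>)
  have A: "f summable_on A" by (rule insert.prems) simp
  have "f summable_on \<Union>\<A>" by (rule insert.IH, rule insert.prems) simp
  then have "f summable_on (\<Union>\<A> - A)" by (rule summable_on_subset_banach) simp
  then have "f summable_on (A \<union> (\<Union>\<A> - A))" by (intro summable_on_Un_disjoint A) simp_all
  then show ?case by simp
qed simp

text \<open>By the M-test the finite partial sums converge uniformly along the net of finite subsets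
  of \<open>I\<close>, and a uniform limit of continuous maps is continuous.\<close>

lemma continuous_map_infsum:
  fixes f :: "'i \<Rightarrow> 'a \<Rightarrow> 'b::banach"
  assumes cont: "\<And>i. i \<in> I \<Longrightarrow> continuous_map T euclidean (f i)"
    and bound: "\<And>i x. i \<in> I \<Longrightarrow> x \<in> topspace T \<Longrightarrow> norm (f i x) \<le> M i" and "M summable_on I"
  shows "continuous_map T euclidean (\<lambda>x. \<Sum>\<^sub>\<infinity>i\<in>I. f i x)"
proof -
  have unif: "uniform_limit (topspace T) (\<lambda>F x. \<Sum>i\<in>F. f i x) (\<lambda>x. \<Sum>\<^sub>\<infinity>i\<in>I. f i x) (finite_subsets_at_top I)"
    using assms by (intro Weierstrass_m_test_general)
  have "continuous_map T Met_TC.mtopology (\<lambda>x. \<Sum>\<^sub>\<infinity>i\<in>I. f i x)"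
  proof (rule Met_TC.continuous_map_uniform_limit)
    have "continuous_map T euclidean (\<lambda>x. \<Sum>i\<in>F. f i x)" if "finite F" "F \<subseteq> I" for F
      using that cont by (intro continuous_map_sum) auto
    then show "\<forall>\<^sub>F F in finite_subsets_at_top I. continuous_map T Met_TC.mtopology (\<lambda>x. \<Sum>i\<in>F. f i x)"
      by (intro eventually_finite_subsets_at_top_weakI) simp
    show "\<forall>\<^sub>F F in finite_subsets_at_top I. \<forall>x\<in>topspace T.
        (\<Sum>\<^sub>\<infinity>i\<in>I. f i x) \<in> UNIV \<and> dist (\<Sum>i\<in>F. f i x) (\<Sum>\<^sub>\<infinity>i\<in>I. f i x) < e" if "0 < e" for e
      using uniform_limitD[OF unif that] by simp
  qed simp
  then show ?thesis by simp
qed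

lemma continuous_map_locally:
  assumes "\<And>x. x \<in> topspace T \<Longrightarrow> \<exists>U. openin T U \<and> x \<in> U \<and> continuous_map (subtopology T U) T' f"
  shows "continuous_map T T' f"
  unfolding continuous_map_eq_topcontinuous_at
proof
  have maps: "f \<in> topspace T \<rightarrow> topspace T'"
  proof
    fix x assume "x \<in> topspace T"
    then obtain U where U: "x \<in> U" "continuous_map (subtopology T U) T' f"
      using assms by blast
    show "f x \<in> topspace T'"
      using continuous_map_funspace[OF U(2)] U(1) \<open>x \<in> topspace T\<close> by auto
  qed
  fix x assume "x \<in> topspace T"
  then obtain U where U: "openin T U" "x \<in> U" "continuous_map (subtopology T U) T' f"
    using assms by blast
  then have "topcontinuous_at (subtopology T U) T' f x"
    using openin_subset[OF U(1)] unfolding continuous_map_eq_topcontinuous_at by auto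
  then show "topcontinuous_at T T' f x"
    unfolding topcontinuous_at_def using U maps \<open>x \<in> topspace T\<close>
    by (auto simp: openin_open_subtopology)
qed

lemma Cc_bounded:
  assumes "f \<in> Cc T"
  obtains B where "0 \<le> B" "\<And>x. x \<in> topspace T \<Longrightarrow> norm (f x) \<le> B"
proof -
  let ?K = "T closure_of {x \<in> topspace T. f x \<noteq> 0}"
  have "compactin euclidean (f ` ?K)"
    using assms by (intro image_compactin[of T]) (auto simp: Cc_def)
  then have "bounded (f ` ?K)" by (simp add: compact_imp_bounded)
  then obtain B where B: "0 < B" "\<And>y. y \<in> f ` ?K \<Longrightarrow> norm y \<le> B"
    unfolding bounded_pos by blast
  have "norm (f x) \<le> B" if "x \<in> topspace T" for x
  proof (cases "f x = 0")
    case False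
    then have "x \<in> ?K" using that by (intro subsetD[OF closure_of_subset]) auto
    then show ?thesis using B by blast
  qed (use B in simp)
  then show ?thesis using that[of B] B(1) by simp
qed

lemma separable_space_weights:
  assumes "separable_space T"
  obtains D :: "'a set" and w :: "'a \<Rightarrow> real" where "countable D" "D \<subseteq> topspace T"
    "\<And>U. openin T U \<Longrightarrow> U \<noteq> {} \<Longrightarrow> D \<inter> U \<noteq> {}" "\<And>x. 0 < w x" "w summable_on D"
proof -
  obtain D where D: "countable D" "D \<subseteq> topspace T" "T closure_of D = topspace T"
    using assms unfolding separable_space_def by blast
  \<comment> \<open>A point gets the weight \<open>(1/2) ^ n\<close> for its number \<open>n\<close>
    in an enumeration of \<open>D\<close>. The numbering is injective, so a geometric series bounds
    the total; the formula is positive off \<open>D\<close> as well.\<close>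
  have "(\<lambda>n. (1/2::real) ^ n) summable_on UNIV"
    by (intro norm_summable_imp_summable_on) simp
  then have "(\<lambda>n. (1/2::real) ^ n) summable_on (to_nat_on D ` D)"
    by (rule summable_on_subset_banach) simp
  then have "(\<lambda>x. (1/2::real) ^ to_nat_on D x) summable_on D"
    using D(1) by (simp add: summable_on_reindex inj_on_to_nat_on o_def)
  then show ?thesis
    using D that[of D "\<lambda>x. (1/2) ^ to_nat_on D x"] by (simp add: dense_intersects_open)
qed

text \<open>\<open>countable_cover\<close> is the form in which countability of the groupoid itself
  enters: it makes the atoms of each fibre countable and supplies the cover for
  \<open>radon_atomic_measure\<close>.\<close>

locale weighted_flat_groupoid = flat_groupoid +
  fixes D :: "'a set" and w :: "'a \<Rightarrow> real"
  assumes countable_D: "countable D"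
    and D_dense: "openin (units G) U \<Longrightarrow> U \<noteq> {} \<Longrightarrow> D \<inter> U \<noteq> {}"
    and w_pos: "\<And>x. 0 < w x"
    and w_summable: "w summable_on D"
    and countable_cover: "\<exists>\<N>. countable \<N> \<and> topspace (arrows G) \<subseteq> \<Union>\<N> \<and>
      (\<forall>N\<in>\<N>. \<exists>g U V. box g U V \<and> N = nbr g U V)"
begin

section \<open>The measures on the fibres\<close>

definition atoms :: "'a \<Rightarrow> 'b set" where
  "atoms u = {h \<in> arr. r h = u \<and> s h \<in> D}"

definition haar :: "'a \<Rightarrow> 'b measure" where
  "haar u = atomic_measure (arrows G) (atoms u) (\<lambda>h. w (s h))"

lemma atoms_subset: "atoms u \<subseteq> arr"
  by (auto simp: atoms_def)

lemma inj_on_src: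
  assumes "box g U V"
  shows "inj_on s (atoms u \<inter> nbr g U V)"
  using inj_on_nbr[OF assms] by (auto simp: inj_on_def atoms_def)

lemma src_atoms: "s ` (atoms u \<inter> A) \<subseteq> D"
  by (auto simp: atoms_def)

text \<open>With its range fixed, an arrow of a basic set is determined by its source. The weights
  of the atoms in it therefore form a subfamily of the summable family \<open>w\<close> on
  \<open>D\<close>; this is the local finiteness of the lifted measure.\<close>

lemma summable_on_atoms_nbr:
  assumes "box g U V"
  shows "(\<lambda>h. w (s h)) summable_on (atoms u \<inter> nbr g U V)"
  using summable_on_subset_banach[OF w_summable src_atoms]
    summable_on_reindex[OF inj_on_src[OF assms], of w u] by (simp add: o_def)

lemma nn_integral_atoms_nbr:
  assumes "box g U V"
  shows "(\<integral>\<^sup>+h. w (s h) \<partial>count_space (atoms u \<inter> nbr g U V)) < \<infinity>"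
proof -
  have "(\<lambda>h. norm (w (s h))) summable_on (atoms u \<inter> nbr g U V)"
    using summable_on_atoms_nbr[OF assms, of u] w_pos by (simp add: less_imp_le)
  then have "integrable (count_space (atoms u \<inter> nbr g U V)) (\<lambda>h. w (s h))"
    using abs_summable_equivalent[of "\<lambda>h. w (s h)"] by (simp add: abs_summable_on_def)
  then show ?thesis
    using w_pos by (simp add: integrable_iff_bounded less_imp_le)
qed

lemma countable_atoms: "countable (atoms u)"
proof -
  obtain \<N> where \<N>: "countable \<N>" "arr \<subseteq> \<Union>\<N>" "\<forall>N\<in>\<N>. \<exists>g U V. box g U V \<and> N = nbr g U V"
    using countable_cover by blast
  have "countable (atoms u \<inter> N)" if N_in: "N \<in> \<N>" for N
  proof -
    obtain g U V where N: "box g U V" "N = nbr g U V" using bspec[OF \<N>(3) N_in] by blast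
    have "countable (s ` (atoms u \<inter> nbr g U V))"
      using src_atoms countable_D by (rule countable_subset)
    then show ?thesis
      unfolding N(2) using inj_on_src[OF N(1)] by (rule countable_image_inj_on)
  qed
  then have "countable (\<Union>N\<in>\<N>. atoms u \<inter> N)"
    using \<N>(1) by blast
  moreover have "atoms u \<subseteq> (\<Union>N\<in>\<N>. atoms u \<inter> N)"
    using \<N>(2) atoms_subset by blast
  ultimately show ?thesis by (rule countable_subset[rotated])
qed

lemma radon_haar: "radon_measure (arrows G) (haar u)"
proof -
  obtain \<N> where \<N>: "countable \<N>" "arr \<subseteq> \<Union>\<N>" "\<forall>N\<in>\<N>. \<exists>g U V. box g U V \<and> N = nbr g U V"
    using countable_cover by blast
  show ?thesis
    unfolding haar_def
  proof (rule radon_atomic_measure[OF Hausdorff_arr atoms_subset countable_atoms \<N>(1)])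
    show "openin (arrows G) N" "(\<integral>\<^sup>+h. w (s h) \<partial>count_space (atoms u \<inter> N)) < \<infinity>" if "N \<in> \<N>" for N
      using bspec[OF \<N>(3) that] openin_nbr nn_integral_atoms_nbr by auto
  qed (rule \<N>(2))
qed

lemma emeasure_haar_open:
  assumes "openin (arrows G) W"
  shows "emeasure (haar u) W = (\<integral>\<^sup>+h. w (s h) \<partial>count_space (atoms u \<inter> W))"
  unfolding haar_def
  using emeasure_atomic_measure[OF atoms_subset openin_sets_borel_of_top[OF assms]]
    emeasure_density_count_space[of "atoms u \<inter> W" "atoms u"] by simp

lemma closedin_range_fibre:
  assumes "u \<in> topspace (units G)"
  shows "closedin (arrows G) (range_fibre G u)"
  using closedin_continuous_map_preimage[OF continuous_map_rng closedin_Hausdorff_sing_eq[OF Hausdorff_units, THEN iffD2, OF assms]]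
  by (simp add: range_fibre_def)

lemma measure_support_haar:
  assumes u: "u \<in> topspace (units G)"
  shows "measure_support (arrows G) (haar u) = range_fibre G u"
proof (intro equalityI subsetI)
  fix h assume h: "h \<in> measure_support (arrows G) (haar u)"
  show "h \<in> range_fibre G u"
  proof (rule ccontr)
    let ?W = "arr - range_fibre G u"
    assume "h \<notin> range_fibre G u"
    then have W: "openin (arrows G) ?W" "h \<in> ?W"
      using h closedin_range_fibre[OF u] by (auto simp: measure_support_def)
    have "atoms u \<inter> ?W = {}" by (auto simp: atoms_def range_fibre_def)
    then have "emeasure (haar u) ?W = 0"
      by (simp add: emeasure_haar_open[OF W(1)] nn_integral_count_space_finite)
    then show False using h W by (auto simp: measure_support_def)
  qed
next
  fix h assume "h \<in> range_fibre G u"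
  then have h: "h \<in> arr" "r h = u" by (auto simp: range_fibre_def)
  have "0 < emeasure (haar u) W" if W: "openin (arrows G) W" "h \<in> W" for W
  proof -
    obtain U V where UV: "box h U V" "nbr h U V \<subseteq> W"
      using openin_arrows_iff W by blast
    then have "openin (units G) V" "V \<noteq> {}"
      by (auto simp: box_def good_open)
    then obtain d where d: "d \<in> D" "d \<in> V"
      using D_dense by blast
    \<comment> \<open>Density of \<open>D\<close> gives a point \<open>d\<close> in
      \<open>V\<close>. Sliding only the source of \<open>h\<close> to \<open>d\<close> stays in the
      fibre over \<open>u\<close> and in \<open>W\<close>, and ends at an atom of positive
      weight.\<close>
    let ?k = "slide h U V u d"
    have u': "u \<in> U" using UV h by (auto simp: box_def)
    have k: "?k \<in> arr" "r ?k = u" "s ?k = d"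
      using slide_closed[OF UV(1) u' d(2)] .
    have "?k \<in> nbr h U V"
      unfolding nbr_def using u' d by blast
    then have mem: "?k \<in> atoms u \<inter> W"
      using k UV d by (auto simp: atoms_def)
    have "0 < ennreal (w (s ?k))" using w_pos by simp
    also have "\<dots> = (\<integral>\<^sup>+h. w (s h) \<partial>count_space {?k})"
      by (simp add: nn_integral_count_space_finite)
    also have "\<dots> = emeasure (density (count_space (atoms u)) (\<lambda>h. w (s h))) {?k}"
      using mem by (intro emeasure_density_count_space[symmetric]) auto
    also have "\<dots> \<le> emeasure (density (count_space (atoms u)) (\<lambda>h. w (s h))) (atoms u \<inter> W)"
      using mem by (intro emeasure_mono) auto
    also have "\<dots> = emeasure (haar u) W"
      by (simp add: emeasure_haar_open[OF W(1)] emeasure_density_count_space)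
    finally show ?thesis .
  qed
  then show "h \<in> measure_support (arrows G) (haar u)"
    using h by (auto simp: measure_support_def)
qed

section \<open>Invariance and continuity of the integral\<close>

lemma integral_haar:
  fixes f :: "'b \<Rightarrow> 'c::{banach, second_countable_topology}"
  assumes "f \<in> borel_measurable (borel_of_top (arrows G))"
  shows "integral\<^sup>L (haar u) f = integral\<^sup>L (count_space (atoms u)) (\<lambda>h. w (s h) *\<^sub>R f h)"
  unfolding haar_def using w_pos
  by (intro integral_atomic_measure[OF atoms_subset assms]) (simp add: less_imp_le)

lemma bij_betw_atoms:
  assumes "a \<in> arr"
  shows "bij_betw (\<lambda>h. a \<cdot> h) (atoms (s a)) (atoms (r a))"
proof (rule bij_betwI)
  show "(\<cdot>) a \<in> atoms (s a) \<rightarrow> atoms (r a)"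
    "(\<cdot>) (inv_arrow G a) \<in> atoms (r a) \<rightarrow> atoms (s a)"
    using assms by (auto simp: atoms_def)
qed (use assms in \<open>auto simp: atoms_def intro: inv_mul_cancel mul_inv_cancel\<close>)

lemma integral_atoms_left_mul:
  fixes f :: "'b \<Rightarrow> 'c::{banach, second_countable_topology}"
  assumes "a \<in> arr"
  shows "integral\<^sup>L (count_space (atoms (s a))) (\<lambda>h. w (s h) *\<^sub>R f (a \<cdot> h)) =
    integral\<^sup>L (count_space (atoms (r a))) (\<lambda>h. w (s h) *\<^sub>R f h)"
proof -
  have "integral\<^sup>L (count_space (atoms (s a))) (\<lambda>h. w (s (a \<cdot> h)) *\<^sub>R f (a \<cdot> h)) =
    integral\<^sup>L (count_space (atoms (r a))) (\<lambda>h. w (s h) *\<^sub>R f h)"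
    by (rule integral_bij_count_space[OF bij_betw_atoms[OF assms]])
  moreover have "integral\<^sup>L (count_space (atoms (s a))) (\<lambda>h. w (s (a \<cdot> h)) *\<^sub>R f (a \<cdot> h)) =
      integral\<^sup>L (count_space (atoms (s a))) (\<lambda>h. w (s h) *\<^sub>R f (a \<cdot> h))"
    using assms by (intro Bochner_Integration.integral_cong) (auto simp: atoms_def)
  ultimately show ?thesis by simp
qed

lemma continuous_map_left_mul:
  assumes a: "a \<in> arr"
  shows "continuous_map (subtopology (arrows G) (range_fibre G (s a))) (arrows G) (\<lambda>h. a \<cdot> h)"
proof -
  let ?F = "range_fibre G (s a)"
  have "continuous_map (subtopology (arrows G) ?F) (prod_topology (arrows G) (arrows G)) (\<lambda>h. (a, h))"
    using a by (intro continuous_map_pairedI continuous_map_from_subtopology[of _ _ "\<lambda>h. h"]) simp_all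
  moreover have "(\<lambda>h. (a, h)) \<in> topspace (subtopology (arrows G) ?F) \<rightarrow> composable G"
    using a by (auto simp: composable_def range_fibre_def)
  ultimately have "continuous_map (subtopology (arrows G) ?F)
      (subtopology (prod_topology (arrows G) (arrows G)) (composable G)) (\<lambda>h. (a, h))"
    by (rule continuous_map_into_subtopology)
  from continuous_map_compose[OF this continuous_map_mul] show ?thesis
    by (simp add: o_def)
qed

lemma haar_invariance:
  assumes a: "a \<in> arr" and f: "f \<in> Cc (arrows G)"
  shows "(LINT \<eta>:range_fibre G (s a)|haar (s a). f (a \<cdot> \<eta>)) = (LINT \<eta>:range_fibre G (r a)|haar (r a). f \<eta>)"
proof -
  have cont: "continuous_map (arrows G) euclidean f" using f by (simp add: Cc_def)
  \<comment> \<open>All atoms over \<open>u\<close> lie in the fibre over \<open>u\<close>, so the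
    indicators of the two set integrals disappear once the integrals are sums over atoms.\<close>
  have ind: "indicator (range_fibre G u) h = (1::real)" if "h \<in> atoms u" for u h
    using that by (simp add: atoms_def range_fibre_def)
  have "(LINT \<eta>:range_fibre G (s a)|haar (s a). f (a \<cdot> \<eta>)) =
      integral\<^sup>L (count_space (atoms (s a))) (\<lambda>h. w (s h) *\<^sub>R indicator (range_fibre G (s a)) h *\<^sub>R f (a \<cdot> h))"
    unfolding set_lebesgue_integral_def
    using continuous_map_compose[OF continuous_map_left_mul[OF a] cont]
    by (intro integral_haar borel_measurable_continuous_map_closedin closedin_range_fibre src_in[OF a])
      (simp add: o_def)
  also have "\<dots> = integral\<^sup>L (count_space (atoms (s a))) (\<lambda>h. w (s h) *\<^sub>R f (a \<cdot> h))"
    by (intro Bochner_Integration.integral_cong) (auto simp: ind)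
  also have "\<dots> = integral\<^sup>L (count_space (atoms (r a))) (\<lambda>h. w (s h) *\<^sub>R f h)"
    by (rule integral_atoms_left_mul[OF a])
  also have "\<dots> = integral\<^sup>L (count_space (atoms (r a))) (\<lambda>h. w (s h) *\<^sub>R indicator (range_fibre G (r a)) h *\<^sub>R f h)"
    by (intro Bochner_Integration.integral_cong) (auto simp: ind)
  also have "\<dots> = (LINT \<eta>:range_fibre G (r a)|haar (r a). f \<eta>)"
    unfolding set_lebesgue_integral_def
    using cont
    by (intro integral_haar[symmetric] borel_measurable_continuous_map_closedin closedin_range_fibre
        rng_in[OF a] continuous_map_from_subtopology)
  finally show ?thesis .
qed

text \<open>Moving the range of \<open>h\<close> through \<open>U\<close> while the source stays
  fixed is a slide, hence continuous. In the integral below this makes each single summand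
  continuous in \<open>u\<close>.\<close>

lemma continuous_map_\<sigma>_mul:
  assumes U: "good U" and h: "h \<in> arr" "r h \<in> U"
  shows "continuous_map (subtopology (units G) U) (arrows G) (\<lambda>u. \<sigma> U u (r h) \<cdot> h)"
proof -
  obtain V where V: "good V" "s h \<in> V"
    using good_base[OF openin_topspace src_in[OF h(1)]] by blast
  then have UV: "box h U V" using U h by (simp add: box_def)
  have sh: "s h \<in> topspace (units G)" using src_in h by blast
  have "continuous_map (subtopology (units G) U) (prod_topology (units G) (units G)) (\<lambda>u. (u, s h))"
    using sh by (intro continuous_map_pairedI continuous_map_from_subtopology[of _ _ "\<lambda>u. u"]) simp_all
  then have "continuous_map (subtopology (units G) U)
      (subtopology (prod_topology (units G) (units G)) (U \<times> V)) (\<lambda>u. (u, s h))"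
    by (rule continuous_map_into_subtopology) (use V in auto)
  from continuous_map_compose[OF this continuous_map_slide[OF UV]]
  have "continuous_map (subtopology (units G) U) (arrows G) (\<lambda>u. slide h U V u (s h))"
    by (simp add: o_def)
  moreover have "slide h U V u (s h) = \<sigma> U u (r h) \<cdot> h" for u
    using V h by (simp add: slide_def \<sigma>_refl)
  ultimately show ?thesis by simp
qed

text \<open>By compactness, the arrows of \<open>supp f\<close> whose range lies near \<open>u\<^sub>0\<close> are translates of
  arrows in finitely many of the sets \<open>nbr a U V\<close> with \<open>r a = u\<^sub>0\<close>.\<close>

lemma Cc_support_near:
  assumes f: "f \<in> Cc (arrows G)" and u0: "u0 \<in> topspace (units G)"
  obtains U E where "good U" "u0 \<in> U" "E \<subseteq> atoms u0" "(\<lambda>h. w (s h)) summable_on E"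
    "\<And>h. h \<in> atoms u0 - E \<Longrightarrow> \<forall>u\<in>U. f (\<sigma> U u u0 \<cdot> h) = 0"
proof -
  define K where "K = arrows G closure_of {h \<in> arr. f h \<noteq> 0}"
  have K: "compactin (arrows G) K" using f by (simp add: Cc_def K_def)
  have fK: "h \<in> K" if "h \<in> arr" "f h \<noteq> 0" for h
    unfolding K_def using that by (intro subsetD[OF closure_of_subset]) auto
  have Karr: "K \<subseteq> arr" unfolding K_def by (rule closure_of_subset_topspace)
  \<comment> \<open>Around an arrow with range \<open>u0\<close> any box will do. Around any other
    arrow of \<open>K\<close> the box is shrunk, by the Hausdorff property of the unit space, until
    its ranges avoid a neighbourhood \<open>W\<close> of \<open>u0\<close>.\<close>
  have "\<exists>U V W. box a U V \<and> openin (units G) W \<and> u0 \<in> W \<and> (r a = u0 \<and> W \<subseteq> U \<or> disjnt U W)"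
    if a: "a \<in> K" for a
  proof (cases "r a = u0")
    case True
    have "a \<in> arr" using a Karr by blast
    then obtain U V where "box a U V"
      by (rule box_base[OF _ openin_topspace _ openin_topspace]) (use \<open>a \<in> arr\<close> rng_in src_in in auto)
    then show ?thesis using True by (intro exI[of _ U] exI[of _ V]) (auto simp: box_def good_open)
  next
    case False
    have "a \<in> arr" using a Karr by blast
    then obtain A W where A: "openin (units G) A" "openin (units G) W" "r a \<in> A" "u0 \<in> W" "disjnt A W"
      using Hausdorff_units False u0 rng_in[of a] unfolding Hausdorff_space_def by metis
    obtain U V where "box a U V" "U \<subseteq> A"
      by (rule box_base[OF \<open>a \<in> arr\<close> A(1,3) openin_topspace src_in[OF \<open>a \<in> arr\<close>]])
    then show ?thesis using A disjnt_subset1 by blast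
  qed
  then obtain U V W where UVW: "\<And>a. a \<in> K \<Longrightarrow> box a (U a) (V a)" "\<And>a. a \<in> K \<Longrightarrow> openin (units G) (W a)"
    "\<And>a. a \<in> K \<Longrightarrow> u0 \<in> W a" "\<And>a. a \<in> K \<Longrightarrow> r a = u0 \<and> W a \<subseteq> U a \<or> disjnt (U a) (W a)"
    by metis
  let ?N = "\<lambda>a. nbr a (U a) (V a)"
  have "\<exists>\<F>. finite \<F> \<and> \<F> \<subseteq> ?N ` K \<and> K \<subseteq> \<Union>\<F>"
  proof (rule compactinD[OF K])
    show "openin (arrows G) A" if "A \<in> ?N ` K" for A
      using that UVW(1) openin_nbr by auto
    show "K \<subseteq> \<Union>(?N ` K)"
      using UVW(1) nbr_self by auto
  qed
  then obtain \<F> where \<F>: "finite \<F>" "\<F> \<subseteq> ?N ` K" "K \<subseteq> \<Union>\<F>"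
    by blast
  obtain S where "S \<subseteq> K" "finite S" "\<F> = ?N ` S"
    using finite_subset_image[OF \<F>(1,2)] by blast
  then have S: "finite S" "S \<subseteq> K" "K \<subseteq> (\<Union>a\<in>S. ?N a)"
    using \<F>(3) by simp_all
  \<comment> \<open>Intersecting with \<open>topspace (units G)\<close> covers the case
    \<open>S = {}\<close>, where the indexed intersection is the whole type.\<close>
  have W_open: "openin (units G) (topspace (units G) \<inter> (\<Inter>a\<in>S. W a))"
    using S UVW(2) openin_INT[of S "units G" W] by (cases "S = {}") (auto simp: Int_commute)
  have u0_W: "u0 \<in> topspace (units G) \<inter> (\<Inter>a\<in>S. W a)"
    using u0 S(2) UVW(3) by blast
  obtain U0 where U0: "good U0" "u0 \<in> U0" "U0 \<subseteq> topspace (units G) \<inter> (\<Inter>a\<in>S. W a)"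
    using good_base[OF W_open u0_W] by blast
  define E where "E = (\<Union>a\<in>S. atoms u0 \<inter> ?N a)"
  show ?thesis
  proof (rule that[OF U0(1,2)])
    show "E \<subseteq> atoms u0" by (auto simp: E_def)
    show "(\<lambda>h. w (s h)) summable_on E"
      unfolding E_def using S UVW(1) by (intro summable_on_finite_Union) (auto intro!: summable_on_atoms_nbr)
    fix h assume h: "h \<in> atoms u0 - E"
    show "\<forall>u\<in>U0. f (\<sigma> U0 u u0 \<cdot> h) = 0"
    proof (rule ballI, rule ccontr)
      fix u assume u: "u \<in> U0" and ne: "f (\<sigma> U0 u u0 \<cdot> h) \<noteq> 0"
      let ?k = "\<sigma> U0 u u0 \<cdot> h"
      have h': "h \<in> arr" "r h = u0" using h by (auto simp: atoms_def)
      have k: "?k \<in> arr" "r ?k = u" "s ?k = s h"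
        using h' U0 u by auto
      obtain a where a: "a \<in> S" "?k \<in> ?N a"
        using fK[OF k(1) ne] S by blast
      then have aK: "a \<in> K" using S by blast
      have "?k = slide a (U a) (V a) u (s h)" "u \<in> U a" "s h \<in> V a"
        using a(2) nbr_iff[OF UVW(1)[OF aK]] k by auto
      note ka = this
      have "u \<in> W a" using U0 u a by auto
      then have "r a = u0" "W a \<subseteq> U a"
        using UVW(4)[OF aK] ka(2) by (auto simp: disjnt_iff)
      then have sub: "U0 \<subseteq> U a" using U0 a by auto
      have gU: "good (U a)" using UVW(1)[OF aK] by (simp add: box_def)
      \<comment> \<open>Moving \<open>?k\<close> back to the range \<open>u0\<close> does not leave
        the basic set around \<open>a\<close>, because the short arrows of \<open>U0\<close> and of
        \<open>U a\<close> agree. This puts \<open>h\<close> into \<open>E\<close>.\<close>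
      have "h = \<sigma> U0 u0 u \<cdot> ?k"
        using h' U0 u by (simp add: \<sigma>_refl unit_mul_eq)
      also have "\<dots> = \<sigma> (U a) u0 u \<cdot> ?k"
        using \<sigma>_mono[OF gU U0(1) sub u U0(2)] by simp
      also have "\<dots> = slide a (U a) (V a) u0 (s h)"
        unfolding ka(1) using \<sigma>_slide[OF UVW(1)[OF aK] ka(2,3)] sub U0 by blast
      finally have "h \<in> ?N a"
        using ka(3) sub U0 unfolding nbr_def by blast
      then show False using h a by (auto simp: E_def)
    qed
  qed
qed

text \<open>Left multiplication by \<open>\<sigma> U u u0\<close> matches the atoms over
  \<open>u0\<close> with those over \<open>u\<close> and keeps their weights. The integrals for all
  \<open>u\<close> in \<open>U\<close> thus become sums over one index set; the terms outside
  \<open>E\<close> vanish and those in \<open>E\<close> are dominated by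
  \<open>B * w (s h)\<close>.\<close>

lemma continuous_map_integral_haar:
  assumes f: "f \<in> Cc (arrows G)"
  shows "continuous_map (units G) euclidean (\<lambda>u. LINT \<eta>|haar u. f \<eta>)"
proof (rule continuous_map_locally)
  fix u0 assume u0: "u0 \<in> topspace (units G)"
  have cont: "continuous_map (arrows G) euclidean f" using f by (simp add: Cc_def)
  obtain U E where U: "good U" "u0 \<in> U" and E: "E \<subseteq> atoms u0" "(\<lambda>h. w (s h)) summable_on E"
    "\<And>h. h \<in> atoms u0 - E \<Longrightarrow> \<forall>u\<in>U. f (\<sigma> U u u0 \<cdot> h) = 0"
    using Cc_support_near[OF f u0] by blast
  obtain B where B: "0 \<le> B" "\<And>h. h \<in> arr \<Longrightarrow> norm (f h) \<le> B"
    using Cc_bounded[OF f] by blast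
  define F where "F h u = w (s h) *\<^sub>R f (\<sigma> U u u0 \<cdot> h)" for h u
  have E_arr: "h \<in> arr" "r h = u0" if "h \<in> E" for h
    using that E(1) by (auto simp: atoms_def)
  have top: "topspace (subtopology (units G) U) = U"
    using good_subset[OF U(1)] by auto
  have bound: "norm (F h u) \<le> B * w (s h)" if "h \<in> E" "u \<in> U" for h u
  proof -
    have "norm (f (\<sigma> U u u0 \<cdot> h)) \<le> B"
      using that E_arr U by (intro B) simp
    then show ?thesis
      using w_pos[of "s h"] by (simp add: F_def mult.commute mult_left_mono)
  qed
  have summ: "(\<lambda>h. B * w (s h)) summable_on E"
    using E(2) by (rule summable_on_cmult_right)
  have "continuous_map (subtopology (units G) U) euclidean (\<lambda>u. \<Sum>\<^sub>\<infinity>h\<in>E. F h u)"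
  proof (rule continuous_map_infsum[OF _ _ summ])
    fix h assume h: "h \<in> E"
    have "continuous_map (subtopology (units G) U) euclidean (\<lambda>u. f (\<sigma> U u u0 \<cdot> h))"
      using continuous_map_compose[OF continuous_map_\<sigma>_mul[OF U(1), of h] cont] E_arr[OF h] U
      by (simp add: o_def)
    moreover have "continuous_map euclidean euclidean (\<lambda>z::complex. w (s h) *\<^sub>R z)"
      by (simp add: continuous_intros)
    ultimately show "continuous_map (subtopology (units G) U) euclidean (F h)"
      using continuous_map_compose unfolding F_def o_def by blast
  qed (use bound top in auto)
  moreover have "(\<Sum>\<^sub>\<infinity>h\<in>E. F h u) = (LINT \<eta>|haar u. f \<eta>)" if u: "u \<in> U" for u
  proof -
    have a: "\<sigma> U u u0 \<in> arr" "s (\<sigma> U u u0) = u0" "r (\<sigma> U u u0) = u"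
      using U u by auto
    have "(LINT \<eta>|haar u. f \<eta>) = integral\<^sup>L (count_space (atoms u)) (\<lambda>h. w (s h) *\<^sub>R f h)"
      by (rule integral_haar[OF borel_measurable_continuous_map[OF cont]])
    also have "\<dots> = infsetsum (\<lambda>h. F h u) (atoms u0)"
      using integral_atoms_left_mul[OF a(1), of f] a by (simp add: infsetsum_def F_def)
    also have "\<dots> = infsetsum (\<lambda>h. F h u) E"
      using E(1,3) u by (intro infsetsum_cong_neutral) (auto simp: F_def)
    also have "\<dots> = (\<Sum>\<^sub>\<infinity>h\<in>E. F h u)"
      unfolding infsetsum_def
      by (intro integral_count_space_eq_infsum Infinite_Sum.abs_summable_on_comparison_test'[OF summ] bound u)
    finally show ?thesis ..
  qed
  ultimately have "continuous_map (subtopology (units G) U) euclidean (\<lambda>u. LINT \<eta>|haar u. f \<eta>)"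
    by (rule continuous_map_eq) (use top in auto)
  then show "\<exists>U. openin (units G) U \<and> u0 \<in> U \<and>
      continuous_map (subtopology (units G) U) euclidean (\<lambda>u. LINT \<eta>|haar u. f \<eta>)"
    using U good_open by blast
qed

text \<open>The integral vanishes at \<open>u\<close> when the fibre over \<open>u\<close> misses
  the support of \<open>f\<close>. Its support hence lies in the image of that compact set under
  \<open>r\<close>, which is compact and, the unit space being Hausdorff, closed.\<close>

lemma integral_haar_Cc:
  assumes f: "f \<in> Cc (arrows G)"
  shows "(\<lambda>u. LINT \<eta>|haar u. f \<eta>) \<in> Cc (units G)"
proof -
  let ?K = "arrows G closure_of {h \<in> arr. f h \<noteq> 0}"
  let ?S = "{u \<in> topspace (units G). (LINT \<eta>|haar u. f \<eta>) \<noteq> 0}"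
  have cont: "continuous_map (arrows G) euclidean f" using f by (simp add: Cc_def)
  have rK: "compactin (units G) (r ` ?K)"
    using f continuous_map_rng by (intro image_compactin[of "arrows G"]) (auto simp: Cc_def)
  have "?S \<subseteq> r ` ?K"
  proof
    fix u assume u: "u \<in> ?S"
    show "u \<in> r ` ?K"
    proof (rule ccontr)
      assume nu: "u \<notin> r ` ?K"
      have "f h = 0" if "h \<in> atoms u" for h
      proof (rule ccontr)
        assume "f h \<noteq> 0"
        then have "h \<in> ?K"
          using that by (intro subsetD[OF closure_of_subset]) (auto simp: atoms_def)
        then show False using nu that by (auto simp: atoms_def)
      qed
      then have "integral\<^sup>L (count_space (atoms u)) (\<lambda>h. w (s h) *\<^sub>R f h) =
          integral\<^sup>L (count_space (atoms u)) (\<lambda>h. 0)"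
        by (intro Bochner_Integration.integral_cong) auto
      then show False
        using u integral_haar[OF borel_measurable_continuous_map[OF cont], of u] by simp
    qed
  qed
  then have "units G closure_of ?S \<subseteq> r ` ?K"
    using compactin_imp_closedin[OF Hausdorff_units rK] by (rule closure_of_minimal)
  then have "compactin (units G) (units G closure_of ?S)"
    using rK closedin_closure_of by (blast intro: closed_compactin)
  then show ?thesis
    using continuous_map_integral_haar[OF f] by (simp add: Cc_def)
qed

lemma haar_system_haar: "haar_system G haar"
proof -
  interpret locally_compact_groupoid G by (rule locally_compact)
  show ?thesis
    by unfold_locales
      (use radon_haar measure_support_haar integral_haar_Cc haar_invariance in auto)
qed

end

section \<open>The fundamental groupoid\<close>

abbreviation path_topology :: "'a topology \<Rightarrow> (real \<Rightarrow> 'a) topology" where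
  "path_topology X \<equiv> compact_open_topology (top_of_set {0..1}) X"

lemma openin_path_topology_subbasis:
  assumes "compact K" "K \<subseteq> {0..1}" "openin X U"
  shows "openin (path_topology X) {p. pathin X p \<and> p ` K \<subseteq> U}"
  unfolding compact_open_topology_def
proof (rule topology_generated_by_Basis)
  have "compactin (top_of_set {0..1}) K"
    using assms by (simp add: compactin_subtopology)
  then show "{p. pathin X p \<and> p ` K \<subseteq> U} \<in>
      {{f. continuous_map (top_of_set {0..1}) X f \<and> f ` K \<subseteq> U} | K U.
        compactin (top_of_set {0..1}) K \<and> openin X U}"
    using assms(3) unfolding pathin_def by blast
qed

lemma openin_path_topology_eval:
  assumes "t \<in> {0..1}" "openin X U"
  shows "openin (path_topology X) {p. pathin X p \<and> p t \<in> U}"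
  using openin_path_topology_subbasis[of "{t}" X U] assms by simp

section \<open>Path classes as arrows of a groupoid\<close>

lemma fundamental_groupoid_simps:
  "arrows (fundamental_groupoid X) = quotient_topology (path_topology X) (path_class X)"
  "units (fundamental_groupoid X) = X"
  "unit_arrow (fundamental_groupoid X) x = path_class X (\<lambda>t. x)"
  by (simp_all add: fundamental_groupoid_def)

lemma quotient_map_path_class:
  "quotient_map (path_topology X) (arrows (fundamental_groupoid X)) (path_class X)"
  by (simp add: fundamental_groupoid_simps quotient_map_quotient_topology)

lemma topspace_arrows:
  "topspace (arrows (fundamental_groupoid X)) = path_class X ` {p. pathin X p}"
  using quotient_imp_surjective_map[OF quotient_map_path_class, of X] by (simp add: pathin_def)

lemma path_class_in_arrows: "pathin X p \<Longrightarrow> path_class X p \<in> topspace (arrows (fundamental_groupoid X))"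
  by (simp add: topspace_arrows)

lemma arrow_cases:
  assumes "a \<in> topspace (arrows (fundamental_groupoid X))"
  obtains p where "pathin X p" "a = path_class X p"
  using assms unfolding topspace_arrows by blast

lemma path_class_self: "pathin X p \<Longrightarrow> p \<in> path_class X p"
  by (simp add: path_class_def path_homotopic_refl)

lemma path_class_eqI: "path_homotopic X p q \<Longrightarrow> path_class X p = path_class X q"
  using path_class_eq_iff path_homotopic_imp(1) by metis

lemma rng_path_class:
  assumes "pathin X p"
  shows "rng (fundamental_groupoid X) (path_class X p) = p 1"
proof -
  have "(\<lambda>p. p 1) ` path_class X p = {p 1}"
    using path_class_self[OF assms] path_homotopic_imp(4) unfolding path_class_def by fastforce
  then show ?thesis by (simp add: fundamental_groupoid_def)
qed

lemma src_path_class: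
  assumes "pathin X p"
  shows "src (fundamental_groupoid X) (path_class X p) = p 0"
proof -
  have "(\<lambda>p. p 0) ` path_class X p = {p 0}"
    using path_class_self[OF assms] path_homotopic_imp(3) unfolding path_class_def by fastforce
  then show ?thesis by (simp add: fundamental_groupoid_def)
qed

lemma mult_path_class:
  assumes "pathin X p" "pathin X q" "p 1 = q 0"
  shows "mult_arrow (fundamental_groupoid X) (path_class X q) (path_class X p) = path_class X (path_then p q)"
proof -
  have "path_class X (path_then p' q') = path_class X (path_then p q)"
    if "q' \<in> path_class X q" "p' \<in> path_class X p" for p' q'
  proof -
    have "path_homotopic X (path_then p q) (path_then p' q')"
      using that assms(3) unfolding path_class_def by (intro path_homotopic_path_then) auto
    then show ?thesis by (rule path_class_eqI[symmetric])
  qed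
  then have "(\<Union>q'\<in>path_class X q. \<Union>p'\<in>path_class X p. path_class X (path_then p' q')) =
      path_class X (path_then p q)"
    using path_class_self[OF assms(1)] path_class_self[OF assms(2)] by blast
  then show ?thesis by (simp add: fundamental_groupoid_def)
qed

lemma inv_path_class:
  assumes "pathin X p"
  shows "inv_arrow (fundamental_groupoid X) (path_class X p) = path_class X (path_reverse p)"
proof -
  have "path_class X (path_reverse p') = path_class X (path_reverse p)" if "p' \<in> path_class X p" for p'
  proof -
    have "path_homotopic X (path_reverse p) (path_reverse p')"
      using that unfolding path_class_def by (intro path_homotopic_path_reverse) auto
    then show ?thesis by (rule path_class_eqI[symmetric])
  qed
  then have "(\<Union>p'\<in>path_class X p. path_class X (path_reverse p')) = path_class X (path_reverse p)"
    using path_class_self[OF assms] by blast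
  then show ?thesis by (simp add: fundamental_groupoid_def)
qed

lemma pathin_ends: "pathin X p \<Longrightarrow> p 0 \<in> topspace X" "pathin X p \<Longrightarrow> p 1 \<in> topspace X"
  unfolding pathin_def continuous_map_def by auto

lemma composable_cases:
  assumes "(a, b) \<in> composable (fundamental_groupoid X)"
  obtains p q where "pathin X p" "pathin X q" "p 1 = q 0" "a = path_class X q" "b = path_class X p"
proof -
  obtain p q where "pathin X p" "b = path_class X p" "pathin X q" "a = path_class X q"
    using assms unfolding composable_def by (auto elim!: arrow_cases)
  moreover have "p 1 = q 0"
    using assms calculation by (simp add: composable_def src_path_class rng_path_class)
  ultimately show ?thesis using that by blast
qed

lemma algebraic_groupoid_fundamental: "algebraic_groupoid (fundamental_groupoid X)"
proof
  let ?G = "fundamental_groupoid X"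
  fix a assume "a \<in> topspace (arrows ?G)"
  then obtain p where p: "pathin X p" and a: "a = path_class X p" by (rule arrow_cases)
  note p' = pathin_path_reverse[OF p]
  show "rng ?G a \<in> topspace (units ?G)" "src ?G a \<in> topspace (units ?G)"
    using p pathin_ends by (auto simp: a rng_path_class src_path_class fundamental_groupoid_simps)
  show "inv_arrow ?G a \<in> topspace (arrows ?G)"
    using p p' by (simp add: a inv_path_class path_class_in_arrows)
  have const: "pathin X (\<lambda>t. p 0)" "pathin X (\<lambda>t. p 1)"
    using pathin_ends[OF p] by (auto simp: pathin_const)
  show "mult_arrow ?G (unit_arrow ?G (rng ?G a)) a = a \<and> mult_arrow ?G a (unit_arrow ?G (src ?G a)) = a"
    using p const path_homotopic_const_then[OF p] path_homotopic_then_const[OF p]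
    by (simp add: a rng_path_class src_path_class fundamental_groupoid_simps(3) mult_path_class path_class_eqI)
  show "rng ?G (inv_arrow ?G a) = src ?G a \<and> src ?G (inv_arrow ?G a) = rng ?G a"
    using p p' by (simp add: a inv_path_class rng_path_class src_path_class)
  show "mult_arrow ?G a (inv_arrow ?G a) = unit_arrow ?G (rng ?G a) \<and>
      mult_arrow ?G (inv_arrow ?G a) a = unit_arrow ?G (src ?G a)"
    using p p' path_homotopic_then_reverse[OF p] path_homotopic_reverse_then[OF p]
    by (simp add: a inv_path_class rng_path_class src_path_class mult_path_class
        fundamental_groupoid_simps(3) path_class_eqI)
next
  let ?G = "fundamental_groupoid X"
  fix u assume "u \<in> topspace (units ?G)"
  then have "pathin X (\<lambda>t. u)" by (simp add: fundamental_groupoid_simps pathin_const)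
  then show "unit_arrow ?G u \<in> topspace (arrows ?G)"
    "rng ?G (unit_arrow ?G u) = u \<and> src ?G (unit_arrow ?G u) = u"
    by (simp_all add: fundamental_groupoid_simps(3) path_class_in_arrows rng_path_class src_path_class)
next
  let ?G = "fundamental_groupoid X"
  fix a b assume "(a, b) \<in> composable ?G"
  then obtain p q where pq: "pathin X p" "pathin X q" "p 1 = q 0" "a = path_class X q" "b = path_class X p"
    by (rule composable_cases)
  have "pathin X (path_then p q)" using pq by (intro pathin_path_then)
  then show "mult_arrow ?G a b \<in> topspace (arrows ?G)"
    "rng ?G (mult_arrow ?G a b) = rng ?G a \<and> src ?G (mult_arrow ?G a b) = src ?G b"
    using pq by (simp_all add: mult_path_class path_class_in_arrows rng_path_class src_path_class)
next
  let ?G = "fundamental_groupoid X"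
  fix a b c assume "(a, b) \<in> composable ?G" "(b, c) \<in> composable ?G"
  then obtain q r where qr: "pathin X q" "pathin X r" "q 1 = r 0" "a = path_class X r" "b = path_class X q"
    by (auto elim: composable_cases)
  have "c \<in> topspace (arrows ?G)" using \<open>(b, c) \<in> _\<close> by (simp add: composable_def)
  then obtain p where p: "pathin X p" "c = path_class X p" by (rule arrow_cases)
  have "p 1 = q 0"
    using \<open>(b, c) \<in> _\<close> qr p by (simp add: composable_def rng_path_class src_path_class)
  then show "mult_arrow ?G (mult_arrow ?G a b) c = mult_arrow ?G a (mult_arrow ?G b c)"
    using qr p path_homotopic_assoc[OF p(1) qr(1,2)]
    by (simp add: mult_path_class pathin_path_then path_class_eqI)
qed

text \<open>Triviality of the map on fundamental groups is phrased for parallel paths instead of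
  loops, so that the class of a path in \<open>U\<close> depends only on its ends. The paths run in
  \<open>U\<close>, but the homotopy may leave it.\<close>

definition good_set :: "'a topology \<Rightarrow> 'a set \<Rightarrow> bool" where
  "good_set X U \<longleftrightarrow> openin X U \<and> path_connectedin X U \<and>
     (\<forall>p q. pathin (subtopology X U) p \<and> pathin (subtopology X U) q \<and> p 0 = q 0 \<and> p 1 = q 1 \<longrightarrow>
       path_homotopic X p q)"

text \<open>On a good set the choice of the path is immaterial, by
  \<open>short_arrow_eq\<close>.\<close>

definition short_arrow :: "'a topology \<Rightarrow> 'a set \<Rightarrow> 'a \<Rightarrow> 'a \<Rightarrow> (real \<Rightarrow> 'a) set" where
  "short_arrow X U y x = path_class X (SOME p. pathin (subtopology X U) p \<and> p 0 = x \<and> p 1 = y)"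

lemma short_arrow_eq:
  assumes "good_set X U" "pathin (subtopology X U) p" "p 0 = x" "p 1 = y"
  shows "short_arrow X U y x = path_class X p"
proof -
  let ?q = "SOME p. pathin (subtopology X U) p \<and> p 0 = x \<and> p 1 = y"
  have "\<exists>p. pathin (subtopology X U) p \<and> p 0 = x \<and> p 1 = y"
    using assms by blast
  then have "pathin (subtopology X U) ?q \<and> ?q 0 = x \<and> ?q 1 = y"
    by (rule someI_ex)
  then have "path_homotopic X ?q p"
    using assms unfolding good_set_def by blast
  then show ?thesis
    unfolding short_arrow_def by (rule path_class_eqI)
qed

lemma good_set_path:
  assumes "good_set X U" "x \<in> U" "y \<in> U"
  obtains p where "pathin (subtopology X U) p" "pathin X p" "p 0 = x" "p 1 = y"
proof -
  obtain p where "pathin X p" "p \<in> {0..1} \<rightarrow> U" "p 0 = x" "p 1 = y"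
    using assms unfolding good_set_def path_connectedin by blast
  then show ?thesis using that[of p] by (auto simp: pathin_subtopology)
qed

text \<open>Semilocal simple connectedness speaks of loops at the single point \<open>x\<close>. For
  parallel paths \<open>p\<close> and \<open>q\<close> in \<open>U\<close>, a path \<open>c\<close>
  in \<open>U\<close> from \<open>x\<close> to their start turns them into the loop
  \<open>c\<close>, \<open>p\<close>, \<open>q\<close> reversed, \<open>c\<close> reversed at
  \<open>x\<close>. It is null homotopic, and cancellation in the groupoid removes \<open>c\<close>
  again.\<close>

lemma good_set_base:
  assumes lpc: "locally_path_connected_space X" and slsc: "semilocally_simply_connected X"
    and W: "openin X W" "x \<in> W"
  shows "\<exists>U. good_set X U \<and> x \<in> U \<and> U \<subseteq> W"
proof -
  interpret algebraic_groupoid "fundamental_groupoid X" by (rule algebraic_groupoid_fundamental)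
  have "x \<in> topspace X" using W openin_subset by blast
  then obtain A where A: "openin X A" "x \<in> A"
    "\<And>p. pathin (subtopology X A) p \<Longrightarrow> p 0 = x \<Longrightarrow> p 1 = x \<Longrightarrow> path_homotopic X p (\<lambda>t. x)"
    using slsc unfolding semilocally_simply_connected_def by metis
  have "openin X (W \<inter> A)" using W A by blast
  then obtain U where U: "openin X U" "path_connectedin X U" "x \<in> U" "U \<subseteq> W \<inter> A"
    using lpc W A unfolding locally_path_connected_space by (metis IntI)
  have "path_homotopic X p q"
    if p: "pathin (subtopology X U) p" and q: "pathin (subtopology X U) q" and "p 0 = q 0" "p 1 = q 1" for p q
  proof -
    have "p 0 \<in> U" using p by (auto simp: pathin_subtopology)
    then obtain c where c: "pathin (subtopology X U) c" "c 0 = x" "c 1 = p 0"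
      using U(2,3) unfolding path_connectedin by (metis PiE pathin_subtopology)
    have X: "pathin X p" "pathin X q" "pathin X c"
      using p q c by (auto simp: pathin_subtopology)
    let ?p = "path_then c p" and ?q = "path_then c q"
    have pq: "pathin (subtopology X U) ?p" "pathin (subtopology X U) ?q"
      using p q c that by (auto intro!: pathin_path_then)
    then have XX: "pathin X ?p" "pathin X ?q" by (auto simp: pathin_subtopology)
    have "pathin (subtopology X U) (path_then ?p (path_reverse ?q))"
      using that by (intro pathin_path_then[OF pq(1) pathin_path_reverse[OF pq(2)]]) simp
    then have "pathin (subtopology X A) (path_then ?p (path_reverse ?q))"
      using U(4) by (auto simp: pathin_subtopology)
    then have "path_homotopic X (path_then ?p (path_reverse ?q)) (\<lambda>t. x)"
      using c by (intro A) simp_all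
    then have "path_class X (path_then ?p (path_reverse ?q)) = unit_arrow (fundamental_groupoid X) x"
      by (simp add: path_class_eqI fundamental_groupoid_simps)
    then have "mult_arrow (fundamental_groupoid X)
        (inv_arrow (fundamental_groupoid X) (path_class X ?q)) (path_class X ?p) =
        unit_arrow (fundamental_groupoid X) x"
      using XX that by (simp add: inv_path_class mult_path_class pathin_path_reverse)
    note eq = this
    have "path_class X ?p = path_class X ?q"
      by (rule eq_if_inv_mul_eq_unit)
        (use XX c that eq in \<open>simp_all add: path_class_in_arrows rng_path_class src_path_class\<close>)
    then have "mult_arrow (fundamental_groupoid X) (path_class X p) (path_class X c) =
        mult_arrow (fundamental_groupoid X) (path_class X q) (path_class X c)"
      using X c that by (simp add: mult_path_class)
    note eq' = this
    have "path_class X p = path_class X q"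
      by (rule mul_right_cancel[OF _ _ _ _ _ eq'])
        (use X c that in \<open>simp_all add: path_class_in_arrows rng_path_class src_path_class\<close>)
    then show ?thesis
      using X by (metis path_class_eq_iff)
  qed
  then have "good_set X U"
    using U unfolding good_set_def by blast
  then show ?thesis using U by blast
qed

locale local_paths_space =
  fixes X :: "'a topology"
  assumes lpc: "locally_path_connected_space X" and slsc: "semilocally_simply_connected X"

sublocale local_paths_space \<subseteq> sectional_groupoid "fundamental_groupoid X" "good_set X" "short_arrow X"
proof -
  let ?G = "fundamental_groupoid X"
  interpret algebraic_groupoid ?G by (rule algebraic_groupoid_fundamental)
  show "sectional_groupoid ?G (good_set X) (short_arrow X)"
  proof
    fix U assume "good_set X U"
    then show "openin (units ?G) U" by (simp add: good_set_def fundamental_groupoid_simps)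
  next
    fix W x assume "openin (units ?G) W" "x \<in> W"
    then show "\<exists>U. good_set X U \<and> x \<in> U \<and> U \<subseteq> W"
      using good_set_base[OF lpc slsc] by (simp add: fundamental_groupoid_simps)
  next
    fix U x y assume *: "good_set X U" "x \<in> U" "y \<in> U"
    then obtain p where "pathin (subtopology X U) p" "pathin X p" "p 0 = x" "p 1 = y"
      by (rule good_set_path)
    then show "short_arrow X U y x \<in> topspace (arrows ?G)" "rng ?G (short_arrow X U y x) = y"
      "src ?G (short_arrow X U y x) = x"
      using short_arrow_eq[OF *(1)] by (auto simp: path_class_in_arrows rng_path_class src_path_class)
  next
    fix U x y z assume *: "good_set X U" "x \<in> U" "y \<in> U" "z \<in> U"
    obtain p where p: "pathin (subtopology X U) p" "pathin X p" "p 0 = x" "p 1 = y"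
      by (rule good_set_path[OF *(1-3)])
    obtain q where q: "pathin (subtopology X U) q" "pathin X q" "q 0 = y" "q 1 = z"
      by (rule good_set_path[OF *(1,3,4)])
    have "pathin (subtopology X U) (path_then p q)"
      using p q by (intro pathin_path_then) auto
    then have "short_arrow X U z x = path_class X (path_then p q)"
      using p q by (intro short_arrow_eq *) auto
    then show "mult_arrow ?G (short_arrow X U z y) (short_arrow X U y x) = short_arrow X U z x"
      using p q short_arrow_eq[OF *(1)] by (auto simp: mult_path_class)
  next
    fix U U' x y assume *: "good_set X U" "good_set X U'" "U' \<subseteq> U" "x \<in> U'" "y \<in> U'"
    obtain p where p: "pathin (subtopology X U') p" "p 0 = x" "p 1 = y"
      by (rule good_set_path[OF *(2,4,5)])
    then have "pathin (subtopology X U) p"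
      using *(3) by (auto simp: pathin_subtopology)
    then show "short_arrow X U' y x = short_arrow X U y x"
      using p short_arrow_eq[OF *(1)] short_arrow_eq[OF *(2)] by metis
  qed
qed

context local_paths_space
begin

notation mul (infixr "\<cdot>" 70)

section \<open>Segments of paths as products of short arrows\<close>

lemma units_X [simp]: "units (fundamental_groupoid X) = X"
  by (simp add: fundamental_groupoid_simps)

abbreviation seg :: "(real \<Rightarrow> 'a) \<Rightarrow> real \<Rightarrow> real \<Rightarrow> (real \<Rightarrow> 'a) set" where
  "seg p a b \<equiv> path_class X (path_segment p a b)"

lemma seg_closed:
  assumes "pathin X p" "a \<in> {0..1}" "b \<in> {0..1}"
  shows "seg p a b \<in> arr" "r (seg p a b) = p b" "s (seg p a b) = p a"
  using pathin_path_segment[OF assms] by (simp_all add: path_class_in_arrows rng_path_class src_path_class)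

lemma seg_mul:
  assumes "pathin X p" "a \<in> {0..1}" "b \<in> {0..1}" "c \<in> {0..1}"
  shows "seg p b c \<cdot> seg p a b = seg p a c"
  using pathin_path_segment[OF assms(1)] assms path_homotopic_path_segment_then[OF assms]
  by (simp add: mult_path_class path_class_eqI)

lemma seg_self: "seg p a a = unit_arrow (fundamental_groupoid X) (p a)"
  by (simp add: path_segment_def fundamental_groupoid_simps)

text \<open>The interval \<open>{l..u}\<close> carries the hypothesis so that \<open>a\<close> and
  \<open>b\<close> may come in either order.\<close>

lemma seg_eq_\<sigma>:
  assumes p: "pathin X p" and B: "good_set X B" "\<And>t. t \<in> {l..u} \<Longrightarrow> p t \<in> B"
    and ab: "a \<in> {l..u}" "b \<in> {l..u}" "{l..u} \<subseteq> {0..1}"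
  shows "seg p a b = short_arrow X B (p b) (p a)"
proof -
  have "pathin X (path_segment p a b)"
    using ab by (intro pathin_path_segment[OF p]) blast+
  moreover have "path_segment p a b t \<in> B" if "t \<in> {0..1}" for t
    unfolding path_segment_def by (rule B(2)[OF convex_combination_in[OF ab(1,2) that]])
  ultimately have "pathin (subtopology X B) (path_segment p a b)"
    by (simp add: pathin_subtopology)
  then show ?thesis
    using short_arrow_eq[OF B(1)] by simp
qed

lemma openin_preimage_path:
  assumes "pathin X p" "openin X B"
  shows "openin (top_of_set {0..1}) {t \<in> {0..1}. p t \<in> B}"
  using openin_continuous_map_preimage[of "top_of_set {0..1}" X p B] assms by (simp add: pathin_def)

lemma path_neighbourhood:
  assumes p: "pathin X p" and t: "t \<in> {0..1}" and B: "openin X B" "p t \<in> B"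
  shows "\<exists>T. openin (top_of_set {0..1}) T \<and> t \<in> T \<and>
    (\<forall>t1\<in>T. \<forall>t2\<in>T. \<exists>l u. t1 \<in> {l..u} \<and> t2 \<in> {l..u} \<and> {l..u} \<subseteq> {0..1} \<and> p ` {l..u} \<subseteq> B)"
proof -
  obtain A where A: "open A" "{t \<in> {0..1}. p t \<in> B} = {0..1} \<inter> A"
    using openin_preimage_path[OF p B(1)] by (auto simp: openin_open)
  have "t \<in> A" using A(2) t B(2) by blast
  then obtain e where e: "0 < e" "ball t e \<subseteq> A"
    using A(1) open_contains_ball by blast
  let ?T = "{0..1} \<inter> {t - e<..<t + e}"
  have "\<exists>l u. t1 \<in> {l..u} \<and> t2 \<in> {l..u} \<and> {l..u} \<subseteq> {0..1} \<and> p ` {l..u} \<subseteq> B"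
    if "t1 \<in> ?T" "t2 \<in> ?T" for t1 t2
  proof (intro exI conjI)
    let ?I = "{min t1 t2..max t1 t2}"
    have "?I \<subseteq> {t - e<..<t + e}" and I: "?I \<subseteq> {0..1}" using that by auto
    then have "?I \<subseteq> A" using e(2) by (auto simp: ball_eq_greaterThanLessThan)
    then show "p ` ?I \<subseteq> B" using I A(2) by blast
  qed (use that in auto)
  moreover have "openin (top_of_set {0..1}) ?T" by (simp add: openin_open_Int)
  ultimately show ?thesis using t e(1) by (intro exI[of _ ?T]) auto
qed

text \<open>Connectedness of \<open>{0..1}\<close> replaces a subdivision with a Lebesgue number: a
  property that passes between any two parameters of a short interval spreads from 0 to
  \<open>t\<close>.\<close>

lemma path_induct [consumes 2, case_names start step]:
  assumes p: "pathin X p" and t: "t \<in> {0..1}" and "P 0"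
    and step: "\<And>t. t \<in> {0..1} \<Longrightarrow> \<exists>B. openin X B \<and> p t \<in> B \<and>
      (\<forall>l u t1 t2. t1 \<in> {l..u} \<and> t2 \<in> {l..u} \<and> {l..u} \<subseteq> {0..1} \<and> p ` {l..u} \<subseteq> B \<and> P t1 \<longrightarrow> P t2)"
  shows "P t"
proof (rule connected_induction_simple[of "{0..1::real}" 0 t P])
  fix a :: real assume a: "a \<in> {0..1}"
  obtain B where B: "openin X B" "p a \<in> B"
    "\<forall>l u t1 t2. t1 \<in> {l..u} \<and> t2 \<in> {l..u} \<and> {l..u} \<subseteq> {0..1} \<and> p ` {l..u} \<subseteq> B \<and> P t1 \<longrightarrow> P t2"
    using step[OF a] by (elim exE conjE)
  obtain T where "openin (top_of_set {0..1}) T" "a \<in> T"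
    "\<forall>t1\<in>T. \<forall>t2\<in>T. \<exists>l u. t1 \<in> {l..u} \<and> t2 \<in> {l..u} \<and> {l..u} \<subseteq> {0..1} \<and> p ` {l..u} \<subseteq> B"
    using path_neighbourhood[OF p a B(1,2)] by (elim exE conjE)
  then show "\<exists>T. openin (top_of_set {0..1}) T \<and> a \<in> T \<and> (\<forall>x\<in>T. \<forall>y\<in>T. P x \<longrightarrow> P y)"
    using B(3) by meson
qed (use t \<open>P 0\<close> in auto)

text \<open>Paths near \<open>p\<close> in the compact-open topology have initial segments that are slides of those
  of \<open>p\<close>; the segment is lengthened through one good set at a time.\<close>

lemma near_path_slide:
  assumes p: "pathin X p" and t: "t \<in> {0..1}"
    and U: "good_set X U" "p t \<in> U" and V: "good_set X V" "p 0 \<in> V"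
  shows "\<exists>M. openin (path_topology X) M \<and> p \<in> M \<and>
    (\<forall>q\<in>M. q t \<in> U \<and> q 0 \<in> V \<and> seg q 0 t = slide (seg p 0 t) U V (q t) (q 0))"
  using p t U
\<comment> \<open>\<open>U\<close> is generalised because the step calls the hypothesis at
  \<open>t1\<close> with the auxiliary good set \<open>B\<close> in its place.\<close>
proof (induction arbitrary: U rule: path_induct)
  case start
  have "openin X (U \<inter> V)" using start V by (auto simp: good_set_def)
  \<comment> \<open>\<open>seg q 0 0\<close> is a unit, and \<open>slide_unit\<close> wants the same
    good set at both ends.\<close>
  then obtain C where C: "good_set X C" "p 0 \<in> C" "C \<subseteq> U \<inter> V"
    using good_base[of "U \<inter> V" "p 0"] start V by auto
  have in0: "(0::real) \<in> {0..1}" by simp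
  note S = seg_closed[OF p in0 in0]
  show ?case
  proof (intro exI conjI ballI)
    show "openin (path_topology X) {q. pathin X q \<and> q 0 \<in> C}"
      using C by (intro openin_path_topology_eval) (auto simp: good_set_def)
    show "p \<in> {q. pathin X q \<and> q 0 \<in> C}" using C p by simp
    fix q assume "q \<in> {q. pathin X q \<and> q 0 \<in> C}"
    then have q: "pathin X q" "q 0 \<in> C" by auto
    then show "q 0 \<in> U" "q 0 \<in> V" using C by auto
    have "seg q 0 0 = slide (seg p 0 0) C C (q 0) (q 0)"
      using slide_unit[OF C(1,2) q(2)] by (simp add: seg_self)
    also have "\<dots> = slide (seg p 0 0) U V (q 0) (q 0)"
      using C q S start V by (intro slide_mono) (auto simp: box_def)
    finally show "seg q 0 0 = slide (seg p 0 0) U V (q 0) (q 0)" .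
  qed
next
  case (step t)
  have "p t \<in> topspace X"
    using p step unfolding pathin_def continuous_map_def by auto
  then obtain B where B: "good_set X B" "p t \<in> B"
    using good_base[of "topspace X" "p t"] by auto
  show ?case
  proof (intro exI[of _ B] conjI allI impI)
    show "openin X B" "p t \<in> B" using B by (auto simp: good_set_def)
    fix l u t1 t2 U
    assume *: "t1 \<in> {l..u} \<and> t2 \<in> {l..u} \<and> {l..u} \<subseteq> {0..1} \<and> p ` {l..u} \<subseteq> B \<and>
      (\<forall>U. good_set X U \<longrightarrow> p t1 \<in> U \<longrightarrow>
        (\<exists>M. openin (path_topology X) M \<and> p \<in> M \<and>
          (\<forall>q\<in>M. q t1 \<in> U \<and> q 0 \<in> V \<and> seg q 0 t1 = slide (seg p 0 t1) U V (q t1) (q 0))))"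
      and U: "good_set X U" "p t2 \<in> U"
    then have t12: "t1 \<in> {l..u}" "t2 \<in> {l..u}" and lu: "{l..u} \<subseteq> {0..1}" and pB: "p ` {l..u} \<subseteq> B"
      by blast+
    have in01: "t1 \<in> {0..1}" "t2 \<in> {0..1}" "(0::real) \<in> {0..1}" using t12 lu by auto
    have pt: "p t1 \<in> B" "p t2 \<in> B" using t12 pB by blast+
    obtain M1 where M1: "openin (path_topology X) M1" "p \<in> M1"
      "\<forall>q\<in>M1. q t1 \<in> B \<and> q 0 \<in> V \<and> seg q 0 t1 = slide (seg p 0 t1) B V (q t1) (q 0)"
      using * B(1) pt(1) by blast
    have "openin X (U \<inter> B)" using U B by (auto simp: good_set_def)
    then obtain C where C: "good_set X C" "p t2 \<in> C" "C \<subseteq> U \<inter> B"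
      using good_base[of "U \<inter> B" "p t2"] U pt by auto
    \<comment> \<open>\<open>M1\<close> controls the segment of \<open>q\<close> up to
      \<open>t1\<close>, the second condition makes its continuation to \<open>t2\<close> a short
      arrow of \<open>B\<close>, and the third puts \<open>q t2\<close> into \<open>C\<close>, where
      slides over \<open>B\<close> and over \<open>U\<close> agree.\<close>
    let ?M = "M1 \<inter> {q. pathin X q \<and> q ` {l..u} \<subseteq> B} \<inter> {q. pathin X q \<and> q t2 \<in> C}"
    have "openin (path_topology X) ?M"
      using M1(1) lu in01 B C
      by (intro openin_Int openin_path_topology_subbasis openin_path_topology_eval) (auto simp: good_set_def)
    moreover have "p \<in> ?M" using M1(2) p pB C(2) by blast
    moreover have "q t2 \<in> U \<and> q 0 \<in> V \<and> seg q 0 t2 = slide (seg p 0 t2) U V (q t2) (q 0)"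
      if "q \<in> ?M" for q
    proof -
      have q: "pathin X q" "q ` {l..u} \<subseteq> B" "q t2 \<in> C" "q \<in> M1" using that by blast+
      have q1: "q t1 \<in> B" "q 0 \<in> V" "seg q 0 t1 = slide (seg p 0 t1) B V (q t1) (q 0)"
        using M1(3) q(4) by blast+
      have q2: "q t2 \<in> B" "q t2 \<in> U" using q(3) C(3) by blast+
      note S1 = seg_closed[OF p in01(3,1)] and S2 = seg_closed[OF p in01(3,2)]
      have box1: "box (seg p 0 t1) B V" using S1 pt B V by (simp add: box_def)
      have box2: "box (seg p 0 t2) B V" using S2 pt B V by (simp add: box_def)
      have boxC: "box (seg p 0 t2) C V" using S2 C V by (simp add: box_def)
      have boxU: "box (seg p 0 t2) U V" using S2 U V by (simp add: box_def)
      have p12: "seg p t1 t2 = short_arrow X B (p t2) (p t1)"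
        using pB by (intro seg_eq_\<sigma>[OF p B(1) _ t12 lu]) auto
      have q12: "seg q t1 t2 = short_arrow X B (q t2) (q t1)"
        using q(2) by (intro seg_eq_\<sigma>[OF q(1) B(1) _ t12 lu]) auto
      have "seg q 0 t2 = seg q t1 t2 \<cdot> seg q 0 t1"
        using seg_mul[OF q(1) in01(3,1,2)] by simp
      also have "\<dots> = slide (seg p 0 t1) B V (q t2) (q 0)"
        unfolding q12 q1(3) by (rule \<sigma>_slide[OF box1 q1(1,2) q2(1)])
      also have "\<dots> = slide (seg p t1 t2 \<cdot> seg p 0 t1) B V (q t2) (q 0)"
        using slide_\<sigma>_mul[OF box1 q2(1) q1(2) pt(2)] S1 by (simp add: p12)
      also have "\<dots> = slide (seg p 0 t2) B V (q t2) (q 0)"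
        using seg_mul[OF p in01(3,1,2)] by simp
      also have "\<dots> = slide (seg p 0 t2) C V (q t2) (q 0)"
        using C(3) by (intro slide_mono[OF box2 boxC _ _ q(3) q1(2), symmetric]) auto
      also have "\<dots> = slide (seg p 0 t2) U V (q t2) (q 0)"
        using C(3) by (intro slide_mono[OF boxU boxC _ _ q(3) q1(2)]) auto
      finally show ?thesis using q1(2) q2(2) by simp
    qed
    ultimately show "\<exists>M. openin (path_topology X) M \<and> p \<in> M \<and>
        (\<forall>q\<in>M. q t2 \<in> U \<and> q 0 \<in> V \<and> seg q 0 t2 = slide (seg p 0 t2) U V (q t2) (q 0))"
      by blast
  qed
qed

text \<open>\<open>near_path_slide\<close> at \<open>t = 1\<close> says that the classes of all
  paths near \<open>p\<close> are slides of the class of \<open>p\<close>; by \<open>nbr_eq\<close>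
  this is membership in the given basic set.\<close>

lemma openin_nbr_path_class:
  assumes g: "box g U V"
  shows "openin (arrows (fundamental_groupoid X)) (nbr g U V)"
  unfolding fundamental_groupoid_simps openin_quotient_topology
proof
  show "nbr g U V \<subseteq> path_class X ` topspace (path_topology X)"
    using nbr_subset_arr[OF g] by (simp add: topspace_arrows pathin_def)
  show "openin (path_topology X) {p \<in> topspace (path_topology X). path_class X p \<in> nbr g U V}"
  proof (subst openin_subopen, intro ballI)
    fix p assume "p \<in> {p \<in> topspace (path_topology X). path_class X p \<in> nbr g U V}"
    then have p: "pathin X p" "path_class X p \<in> nbr g U V" by (auto simp: pathin_def)
    have pbox: "box (path_class X p) U V" using box_of_nbr[OF g p(2)] .
    then have "good_set X U" "p 1 \<in> U" "good_set X V" "p 0 \<in> V"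
      using p(1) by (auto simp: box_def rng_path_class src_path_class)
    then obtain M where M: "openin (path_topology X) M" "p \<in> M"
      "\<forall>q\<in>M. q 1 \<in> U \<and> q 0 \<in> V \<and> seg q 0 1 = slide (seg p 0 1) U V (q 1) (q 0)"
      using near_path_slide[OF p(1) _ \<open>good_set X U\<close> \<open>p 1 \<in> U\<close> \<open>good_set X V\<close> \<open>p 0 \<in> V\<close>]
      by (metis atLeastAtMost_iff order_refl zero_le_one)
    have "path_class X q \<in> nbr g U V" if "q \<in> M" for q
    proof -
      have "q 1 \<in> U" "q 0 \<in> V" "path_class X q = slide (path_class X p) U V (q 1) (q 0)"
        using M(3) that by simp_all
      then have "path_class X q \<in> nbr (path_class X p) U V"
        unfolding nbr_def by blast
      then show ?thesis using nbr_eq[OF g p(2)] by simp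
    qed
    then show "\<exists>T. openin (path_topology X) T \<and> p \<in> T \<and>
        T \<subseteq> {p \<in> topspace (path_topology X). path_class X p \<in> nbr g U V}"
      using M(1,2) openin_subset[OF M(1)] by (intro exI[of _ M]) blast
  qed
qed

end

text \<open>By induction on the generation of \<open>P\<close> from subbasic sets. The path pauses
  at \<open>x\<close> and at \<open>y\<close>, so a condition that \<open>K\<close> be mapped into
  \<open>U\<close> forces \<open>x\<close> or \<open>y\<close> into \<open>U\<close> as soon as
  \<open>K\<close> meets the corresponding pause; a path inside \<open>U\<close> can then replace
  the pause.\<close>

lemma openin_path_topology_ends:
  assumes "openin (path_topology X) P" "path_then (\<lambda>t. x) (path_then \<gamma> (\<lambda>t. y)) \<in> P"
    and "x \<in> topspace X" "y \<in> topspace X" "pathin X \<gamma>"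
  shows "\<exists>A B. openin X A \<and> x \<in> A \<and> openin X B \<and> y \<in> B \<and>
    (\<forall>a b. pathin X a \<and> pathin X b \<and> a ` {0..1} \<subseteq> A \<and> b ` {0..1} \<subseteq> B \<and> a 1 = \<gamma> 0 \<and> \<gamma> 1 = b 0 \<longrightarrow>
      path_then a (path_then \<gamma> b) \<in> P)"
proof -
  let ?S = "{{f. continuous_map (top_of_set {0..1}) X f \<and> f ` K \<subseteq> U} | K U.
      compactin (top_of_set {0..1::real}) K \<and> openin X U}"
  have "generate_topology_on ?S P"
    using assms(1) unfolding compact_open_topology_def openin_topology_generated_by_iff .
  then show ?thesis
    using assms(2)
  proof induction
    case Empty
    then show ?case by simp
  next
    case (Int P Q)
    let ?E = "\<lambda>P A B. openin X A \<and> x \<in> A \<and> openin X B \<and> y \<in> B \<and>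
      (\<forall>a b. pathin X a \<and> pathin X b \<and> a ` {0..1} \<subseteq> A \<and> b ` {0..1} \<subseteq> B \<and> a 1 = \<gamma> 0 \<and> \<gamma> 1 = b 0 \<longrightarrow>
        path_then a (path_then \<gamma> b) \<in> P)"
    obtain A B where 1: "?E P A B" using Int by blast
    obtain A' B' where 2: "?E Q A' B'" using Int by blast
    have "?E (P \<inter> Q) (A \<inter> A') (B \<inter> B')" using 1 2 by (simp add: openin_Int)
    then show ?case by blast
  next
    case (UN K)
    then obtain k where "k \<in> K" "path_then (\<lambda>t. x) (path_then \<gamma> (\<lambda>t. y)) \<in> k" by blast
    then show ?case using UN.IH[of k] by (meson UnionI)
  next
    case (Basis P)
    then obtain K U where K: "compactin (top_of_set {0..1::real}) K" and U: "openin X U"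
      and P: "P = {f. continuous_map (top_of_set {0..1}) X f \<and> f ` K \<subseteq> U}" by blast
    have K01: "K \<subseteq> {0..1}" using compactin_subset_topspace[OF K] by simp
    \<comment> \<open>If \<open>K\<close> misses a pause, that end is unconstrained and
      \<open>topspace X\<close> serves. The last piece is open at 3/4, since
      \<open>path_then\<close> gives the midpoint to its first argument: at 3/4 the path is still on
      \<open>\<gamma>\<close>.\<close>
    define A where "A = (if K \<inter> {..1/2} = {} then topspace X else U)"
    define B where "B = (if K \<inter> {3/4<..} = {} then topspace X else U)"
    let ?\<gamma> = "path_then (\<lambda>t. x) (path_then \<gamma> (\<lambda>t. y))"
    have \<gamma>U: "?\<gamma> t \<in> U" if "t \<in> K" for t using Basis.prems that by (auto simp: P)
    have "x \<in> A"
    proof (cases "K \<inter> {..1/2} = {}")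
      case False
      then obtain t where "t \<in> K" "t \<le> 1/2" by blast
      then show ?thesis using \<gamma>U[of t] False by (simp add: A_def path_then_def)
    qed (simp add: A_def assms)
    moreover have "y \<in> B"
    proof (cases "K \<inter> {3/4<..} = {}")
      case False
      then obtain t where "t \<in> K" "3/4 < t" by blast
      then show ?thesis using \<gamma>U[of t] False by (simp add: B_def path_then_def)
    qed (simp add: B_def assms)
    moreover have "openin X A" "openin X B" using U by (simp_all add: A_def B_def)
    moreover have main: "path_then a (path_then \<gamma> b) \<in> P"
      if a: "pathin X a" and b: "pathin X b" and aA: "a ` {0..1} \<subseteq> A" and bB: "b ` {0..1} \<subseteq> B"
        and ends: "a 1 = \<gamma> 0" "\<gamma> 1 = b 0" for a b
    proof -
      let ?q = "path_then a (path_then \<gamma> b)"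
      have "pathin X ?q"
        using a b ends assms(5) by (intro pathin_path_then) simp_all
      moreover have "?q t \<in> U" if t: "t \<in> K" for t
      proof -
        have t01: "t \<in> {0..1}" using t K01 by blast
        consider "t \<le> 1/2" | "1/2 < t" "t \<le> 3/4" | "3/4 < t" by linarith
        then show ?thesis
        proof cases
          case 1
          then have "A = U" using t by (auto simp: A_def)
          moreover have "2 * t \<in> {0..1}" using 1 t01 by simp
          ultimately show ?thesis using 1 aA by (auto simp: path_then_def)
        next
          case 2
          then have "?q t = ?\<gamma> t" by (simp add: path_then_def)
          then show ?thesis using \<gamma>U[OF t] by simp
        next
          case 3
          then have "B = U" using t by (auto simp: B_def)
          moreover have "2 * (2 * t - 1) - 1 \<in> {0..1}" using 3 t01 by simp
          ultimately have "b (2 * (2 * t - 1) - 1) \<in> U" using bB by blast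
          then show ?thesis using 3 by (simp add: path_then_def)
        qed
      qed
      ultimately show ?thesis by (auto simp: P pathin_def)
    qed
    ultimately show ?case
      by - (rule exI[of _ A], rule exI[of _ B], intro conjI allI impI, assumption+, elim conjE, rule main)
  qed
qed

context local_paths_space
begin

text \<open>Every arrow has a representative that is constant near both ends; short paths can be inserted
  there without leaving a given neighbourhood of it in the compact-open topology.\<close>

lemma nbr_in_openin:
  assumes W: "openin (arrows (fundamental_groupoid X)) W" "g \<in> W"
  shows "\<exists>U V. box g U V \<and> nbr g U V \<subseteq> W"
proof -
  have "g \<in> arr" using W openin_subset by blast
  then obtain \<gamma> where \<gamma>: "pathin X \<gamma>" "g = path_class X \<gamma>" by (rule arrow_cases)
  define P where "P = {p. pathin X p \<and> path_class X p \<in> W}"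
  have P: "openin (path_topology X) P"
    using W(1) unfolding P_def fundamental_groupoid_simps openin_quotient_topology by (simp add: pathin_def)
  have ends: "\<gamma> 0 \<in> topspace X" "\<gamma> 1 \<in> topspace X" using pathin_ends[OF \<gamma>(1)] .
  let ?x = "\<lambda>t::real. \<gamma> 0" and ?y = "\<lambda>t::real. \<gamma> 1"
  have const: "pathin X ?x" "pathin X ?y" using ends by (simp_all add: pathin_const)
  have \<gamma>y: "pathin X (path_then \<gamma> ?y)" using \<gamma> const by (intro pathin_path_then) simp_all
  then have "path_homotopic X (path_then ?x (path_then \<gamma> ?y)) \<gamma>"
    using path_homotopic_const_then[OF \<gamma>y] path_homotopic_then_const[OF \<gamma>(1)]
    by (auto intro: path_homotopic_trans)
  \<comment> \<open>\<open>P\<close> is a union of homotopy classes, so it contains the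
    representative that pauses at both ends.\<close>
  then have "path_then ?x (path_then \<gamma> ?y) \<in> P"
    using W(2) \<gamma>(2) path_class_eqI path_homotopic_imp(1) unfolding P_def by fastforce
  then obtain A B where AB: "openin X A" "\<gamma> 0 \<in> A" "openin X B" "\<gamma> 1 \<in> B"
    "\<forall>a b. pathin X a \<and> pathin X b \<and> a ` {0..1} \<subseteq> A \<and> b ` {0..1} \<subseteq> B \<and> a 1 = \<gamma> 0 \<and> \<gamma> 1 = b 0 \<longrightarrow>
      path_then a (path_then \<gamma> b) \<in> P"
    using openin_path_topology_ends[OF P _ ends \<gamma>(1)] by blast
  obtain U where U: "good_set X U" "\<gamma> 1 \<in> U" "U \<subseteq> B" using good_base[of B "\<gamma> 1"] AB by auto
  obtain V where V: "good_set X V" "\<gamma> 0 \<in> V" "V \<subseteq> A" using good_base[of A "\<gamma> 0"] AB by auto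
  have ends_g: "r g = \<gamma> 1" "s g = \<gamma> 0" using \<gamma> by (simp_all add: rng_path_class src_path_class)
  have "box g U V" using U V \<open>g \<in> arr\<close> ends_g by (simp add: box_def)
  moreover have "slide g U V y x \<in> W" if yx: "y \<in> U" "x \<in> V" for y x
  proof -
    obtain a where a: "pathin (subtopology X V) a" "pathin X a" "a 0 = x" "a 1 = \<gamma> 0"
      by (rule good_set_path[OF V(1) yx(2) V(2)])
    obtain b where b: "pathin (subtopology X U) b" "pathin X b" "b 0 = \<gamma> 1" "b 1 = y"
      by (rule good_set_path[OF U(1,2) yx(1)])
    have sa: "short_arrow X V (\<gamma> 0) x = path_class X a" and sb: "short_arrow X U y (\<gamma> 1) = path_class X b"
      using a b short_arrow_eq[OF V(1)] short_arrow_eq[OF U(1)] by auto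
    have cat: "pathin X (path_then a \<gamma>)" "pathin X (path_then (path_then a \<gamma>) b)"
      using a b \<gamma> by (auto intro!: pathin_path_then)
    have "a ` {0..1} \<subseteq> A" "b ` {0..1} \<subseteq> B"
      using a(1) b(1) U(3) V(3) by (auto simp: pathin_subtopology)
    then have "path_then a (path_then \<gamma> b) \<in> P"
      using AB(5) a b by simp
    then have "path_class X (path_then (path_then a \<gamma>) b) \<in> W"
      using path_class_eqI[OF path_homotopic_assoc[OF a(2) \<gamma>(1) b(2)]] a b by (simp add: P_def)
    moreover have "slide g U V y x = path_class X (path_then (path_then a \<gamma>) b)"
      unfolding slide_def ends_g sa sb unfolding \<gamma>(2) using a b \<gamma> cat by (simp add: mult_path_class)
    ultimately show ?thesis by simp
  qed
  ultimately show ?thesis unfolding nbr_def by blast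
qed

lemma openin_arrows_fundamental_iff:
  "openin (arrows (fundamental_groupoid X)) W \<longleftrightarrow>
    W \<subseteq> arr \<and> (\<forall>g\<in>W. \<exists>U V. box g U V \<and> nbr g U V \<subseteq> W)"
proof
  assume "openin (arrows (fundamental_groupoid X)) W"
  then show "W \<subseteq> arr \<and> (\<forall>g\<in>W. \<exists>U V. box g U V \<and> nbr g U V \<subseteq> W)"
    using nbr_in_openin openin_subset by blast
next
  assume *: "W \<subseteq> arr \<and> (\<forall>g\<in>W. \<exists>U V. box g U V \<and> nbr g U V \<subseteq> W)"
  show "openin (arrows (fundamental_groupoid X)) W"
  proof (subst openin_subopen, intro ballI)
    fix g assume "g \<in> W"
    then obtain U V where UV: "box g U V" "nbr g U V \<subseteq> W" using * by blast
    then show "\<exists>T. openin (arrows (fundamental_groupoid X)) T \<and> g \<in> T \<and> T \<subseteq> W"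
      using openin_nbr_path_class[OF UV(1)] nbr_self[OF UV(1)] by blast
  qed
qed

text \<open>\<open>\<Pi>\<^sub>1(X)\<close> has countable isotropy: up to short arrows at both ends, every arrow is a product of
  short arrows inside members of a countable cover \<open>\<C>\<close>, joined at points of a countable dense set \<open>D\<close>.\<close>

lemma countable_nbr_cover:
  assumes sc: "second_countable X"
  shows "\<exists>\<N>. countable \<N> \<and> arr \<subseteq> \<Union>\<N> \<and> (\<forall>N\<in>\<N>. \<exists>g U V. box g U V \<and> N = nbr g U V)"
proof -
  have "\<forall>U\<in>{U. good_set X U}. openin X U" by (auto simp: good_set_def)
  moreover have "\<Union>{U. good_set X U} = topspace X"
  proof
    show "topspace X \<subseteq> \<Union>{U. good_set X U}"
      using good_base[of "topspace X"] by fastforce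
  qed (auto simp: good_set_def dest: openin_subset)
  ultimately obtain \<C> where \<C>: "countable \<C>" "\<C> \<subseteq> {U. good_set X U}" "\<Union>\<C> = topspace X"
    using second_countable_imp_Lindelof_space[OF sc] unfolding Lindelof_space_def by metis
  obtain D where D: "countable D" "D \<subseteq> topspace X" "X closure_of D = topspace X"
    using second_countable_imp_separable_space[OF sc] unfolding separable_space_def by blast
  have dense: "D \<inter> U \<noteq> {}" if "openin X U" "x \<in> U" for U x
    using D(3) that unfolding dense_intersects_open by blast
  \<comment> \<open>\<open>R n\<close> holds the products of \<open>n\<close> short arrows starting
    from a unit at a point of \<open>D\<close>, with all joints in \<open>D\<close>. No condition
    puts \<open>d\<close> and \<open>r e\<close> into \<open>B\<close>; meaningless products do no
    harm, because \<open>\<N>\<close> keeps only triples that form a box.\<close>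
  define R where "R = rec_nat (unit_arrow (fundamental_groupoid X) ` D)
    (\<lambda>_ E. (\<lambda>(B, d, e). short_arrow X B d (r e) \<cdot> e) ` (\<C> \<times> D \<times> E))"
  have R0: "R 0 = unit_arrow (fundamental_groupoid X) ` D"
    and RSuc: "R (Suc n) = (\<lambda>(B, d, e). short_arrow X B d (r e) \<cdot> e) ` (\<C> \<times> D \<times> R n)" for n
    by (simp_all add: R_def)
  have "countable (R n)" for n
    by (induction n) (use \<C>(1) D(1) in \<open>auto simp: R0 RSuc\<close>)
  then have cR: "countable (\<Union>n. R n)" by blast
  define \<N> where "\<N> = (\<lambda>(e, B, B'). nbr e B B') ` {(e, B, B') \<in> (\<Union>n. R n) \<times> \<C> \<times> \<C>. box e B B'}"
  have "countable ((\<Union>n. R n) \<times> \<C> \<times> \<C>)"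
    using cR \<C>(1) by (intro countable_SIGMA)
  then have "countable {(e, B, B') \<in> (\<Union>n. R n) \<times> \<C> \<times> \<C>. box e B B'}"
    by (rule countable_subset[rotated]) blast
  then have "countable \<N>"
    unfolding \<N>_def by (rule countable_image)
  moreover have "arr \<subseteq> \<Union>\<N>"
  proof
    fix g assume "g \<in> arr"
    then obtain p where p: "pathin X p" "g = path_class X p" by (rule arrow_cases)
    \<comment> \<open>\<open>Q t\<close> says that the segment up to \<open>t\<close> lies in a
      basic set centred at one of the countably many arrows. It is spread along \<open>p\<close> by
      \<open>path_induct\<close>.\<close>
    define Q where "Q t \<longleftrightarrow> (\<exists>n e B B'. e \<in> R n \<and> B \<in> \<C> \<and> B' \<in> \<C> \<and> box e B B' \<and> p t \<in> B \<and> p 0 \<in> B' \<and>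
      seg p 0 t = slide e B B' (p t) (p 0))" for t
    have "(1::real) \<in> {0..1}" by simp
    with p(1) have "Q 1"
    proof (induction rule: path_induct)
      case start
      obtain B where B: "B \<in> \<C>" "p 0 \<in> B" using \<C>(3) pathin_ends(1)[OF p(1)] by blast
      then have gB: "good_set X B" using \<C>(2) by blast
      then obtain d where d: "d \<in> D" "d \<in> B" using dense[of B "p 0"] B by (auto simp: good_set_def)
      let ?e = "unit_arrow (fundamental_groupoid X) d"
      have "d \<in> topspace X" using d D by blast
      then have "box ?e B B"
        using unit_arrow_in[of d] unit_arrow_ends[of d] gB d by (simp add: box_def)
      moreover have "seg p 0 0 = slide ?e B B (p 0) (p 0)"
        using slide_unit[OF gB d(2) B(2)] by (simp add: seg_self)
      moreover have "?e \<in> R 0" using d by (simp add: R0)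
      ultimately show ?case unfolding Q_def using B by blast
    next
      case (step t)
      have "p t \<in> topspace X"
        using p step unfolding pathin_def continuous_map_def by auto
      then obtain B2 where B2: "B2 \<in> \<C>" "p t \<in> B2" using \<C>(3) by blast
      then have gB2: "good_set X B2" using \<C>(2) by blast
      show ?case
      proof (intro exI[of _ B2] conjI allI impI)
        show "openin X B2" "p t \<in> B2" using gB2 B2 by (auto simp: good_set_def)
        fix l u t1 t2
        assume *: "t1 \<in> {l..u} \<and> t2 \<in> {l..u} \<and> {l..u} \<subseteq> {0..1} \<and> p ` {l..u} \<subseteq> B2 \<and> Q t1"
        then have t12: "t1 \<in> {l..u}" "t2 \<in> {l..u}" and lu: "{l..u} \<subseteq> {0..1}" and pB: "p ` {l..u} \<subseteq> B2"
          by blast+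
        have in01: "t1 \<in> {0..1}" "t2 \<in> {0..1}" "(0::real) \<in> {0..1}" using t12 lu by auto
        have pt: "p t1 \<in> B2" "p t2 \<in> B2" using t12 pB by blast+
        obtain n e B B' where e: "e \<in> R n" "B \<in> \<C>" "B' \<in> \<C>" "box e B B'" "p t1 \<in> B" "p 0 \<in> B'"
          "seg p 0 t1 = slide e B B' (p t1) (p 0)"
          using * unfolding Q_def by blast
        have gB: "good_set X B" "good_set X B'" using e \<C>(2) by blast+
        have "openin X (B \<inter> B2)" using gB gB2 by (auto simp: good_set_def)
        then obtain C where C: "good_set X C" "p t1 \<in> C" "C \<subseteq> B \<inter> B2"
          using good_base[of "B \<inter> B2" "p t1"] e pt by auto
        \<comment> \<open>Moving the range of the centre to a point \<open>d\<close> of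
          \<open>B \<inter> B2\<close> makes it the centre of a box over \<open>B2\<close> as well,
          to which the next segment can be attached. \<open>C\<close> lies in both sets and mediates
          between their slides.\<close>
        then obtain d where d: "d \<in> D" "d \<in> C" using dense[of C "p t1"] by (auto simp: good_set_def)
        have dB: "d \<in> B" "d \<in> B2" using d C by blast+
        let ?e = "short_arrow X B d (r e) \<cdot> e"
        have e': "?e \<in> arr" "r ?e = d" "s ?e = s e"
          using e(4) gB dB by (auto simp: box_def)
        have boxes: "box ?e B B'" "box ?e C B'" "box ?e B2 B'"
          using e' e(4) gB gB2 C dB d by (simp_all add: box_def)
        have "?e \<in> R (Suc n)"
          unfolding RSuc using e d by (intro image_eqI[of _ _ "(B, d, e)"]) auto
        have p12: "seg p t1 t2 = short_arrow X B2 (p t2) (p t1)"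
          using pB by (intro seg_eq_\<sigma>[OF p(1) gB2 _ t12 lu]) auto
        have "seg p 0 t1 = slide ?e B B' (p t1) (p 0)"
          unfolding e(7) by (rule slide_\<sigma>_mul[OF e(4,5,6) dB(1), symmetric])
        also have "\<dots> = slide ?e C B' (p t1) (p 0)"
          using C by (intro slide_mono[OF boxes(1,2) _ _ C(2) e(6), symmetric]) auto
        also have "\<dots> = slide ?e B2 B' (p t1) (p 0)"
          using C by (intro slide_mono[OF boxes(3,2) _ _ C(2) e(6)]) auto
        finally have s1: "seg p 0 t1 = slide ?e B2 B' (p t1) (p 0)" .
        have "seg p 0 t2 = seg p t1 t2 \<cdot> seg p 0 t1"
          using seg_mul[OF p(1) in01(3,1,2)] by simp
        also have "\<dots> = slide ?e B2 B' (p t2) (p 0)"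
          unfolding p12 s1 by (rule \<sigma>_slide[OF boxes(3) pt(1) e(6) pt(2)])
        finally show "Q t2"
          unfolding Q_def using \<open>?e \<in> R (Suc n)\<close> B2(1) e(3) boxes(3) pt(2) e(6) by blast
      qed
    qed
    then obtain n e B B' where e: "e \<in> R n" "B \<in> \<C>" "B' \<in> \<C>" "box e B B'" "p 1 \<in> B" "p 0 \<in> B'"
      "g = slide e B B' (p 1) (p 0)"
      unfolding Q_def p(2) by auto
    then have "g \<in> nbr e B B'" unfolding nbr_def by blast
    moreover have "nbr e B B' \<in> \<N>"
      unfolding \<N>_def using e by (intro image_eqI[of _ _ "(e, B, B')"]) auto
    ultimately show "g \<in> \<Union>\<N>" by blast
  qed
  moreover have "\<forall>N\<in>\<N>. \<exists>g U V. box g U V \<and> N = nbr g U V"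
    unfolding \<N>_def by auto
  ultimately show ?thesis by blast
qed

end

theorem corollary2p2:
  fixes X :: "'a topology"
  assumes "path_connected_space X"
    and "locally_path_connected_space X"
    and "semilocally_simply_connected X"
    and "locally_compact_space X"
    and "Hausdorff_space X"
    and "second_countable X"
  shows "\<exists>\<alpha>. haar_system (fundamental_groupoid X) \<alpha>"
proof -
  interpret local_paths_space X using assms by unfold_locales
  obtain D :: "'a set" and w :: "'a \<Rightarrow> real" where D: "countable D"
    "\<And>U. openin X U \<Longrightarrow> U \<noteq> {} \<Longrightarrow> D \<inter> U \<noteq> {}" "\<And>x. 0 < w x" "w summable_on D"
    using separable_space_weights[OF second_countable_imp_separable_space[OF assms(6)]] by metis
  interpret weighted_flat_groupoid "fundamental_groupoid X" "good_set X" "short_arrow X" D w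
  proof unfold_locales
    show "openin (arrows (fundamental_groupoid X)) W \<longleftrightarrow>
        W \<subseteq> arr \<and> (\<forall>g\<in>W. \<exists>U V. box g U V \<and> nbr g U V \<subseteq> W)" for W
      by (rule openin_arrows_fundamental_iff)
    show "\<exists>\<N>. countable \<N> \<and> arr \<subseteq> \<Union>\<N> \<and> (\<forall>N\<in>\<N>. \<exists>g U V. box g U V \<and> N = nbr g U V)"
      by (rule countable_nbr_cover[OF assms(6)])
  qed (use assms D in simp_all)
  show ?thesis using haar_system_haar by blast
qed

end
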